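(* Let $\mathbb{K}$ be a field containing $\mathbb{Q}$ and let $n\in\{1,2,3,\dots\}\cup\{\infty\}$. Let $\mathcal{N}$ be the algebra of symmetric polynomials in the $n$ noncommuting variables $\mathbf{x}$ (defined in the context), graded by degree, and let $\Lambda\subseteq\mathcal{N}$ be the subspace of place-action invariants, i.e. $\Lambda=\mathrm{span}\{\mathbf{m}_\mu\}$. Then there is a graded subspace $\mathcal{C}$ of $\mathcal{N}$ together with an isomorphism of graded vector spaces $\mathcal{N}\simeq\mathcal{C}\otimes\Lambda$.
   Context: Let $\mathbf{x}=\{x_1,\dots,x_n\}$ be noncommuting variables (countably many if $n=\infty$), and $T=\mathbb{K}\langle\mathbf{x}\rangle$ (for $n=\infty$, formal series of bounded degree). A degree-$d$ monomial $\mathbf{z}=z_1\cdots z_d$ is a function $[d]\to\mathbf{x}$; its type $\tau(\mathbf{z})$ is the set partition of $[d]=\{1,\dots,d\}$ formed by the nonempty fibers of $\mathbf{z}$. For a set partition $\mathbf{A}$ of $[d]$ put $m_{\mathbf{A}}=\sum_{\tau(\mathbf{z})=\mathbf{A}}\mathbf{z}$ (so $m_{\mathbf{A}}=0$ if $\mathbf{A}$ has more than $n$ parts; $m_{\emptyset}=1$). $\mathcal{N}$ is the span of all $m_{\mathbf{A}}$; equivalently the invariants of $T$ under permuting the variables. The shape $\lambda(\mathbf{A})$ of a set partition is the integer partition formed by its block sizes; $\mathcal{N}_\mu=\mathrm{span}\{m_{\mathbf{A}}:\lambda(\mathbf{A})=\mu\}$. The symmetric group $\mathfrak{S}_d$ acts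 on $\mathcal{N}_d$ (the degree-$d$ part) on the right by the place-action $m_{\mathbf{A}}\cdot\rho=m_{\rho^{-1}\cdot\mathbf{A}}$, where $\rho^{-1}\cdot\{A_1,\dots,A_r\}=\{\rho^{-1}(A_1),\dots,\rho^{-1}(A_r)\}$ (induced from $\mathbf{z}\mapsto\mathbf{z}\circ\rho$). For a partition $\mu=1^{a_1}2^{a_2}\cdots$ of $d$ put $\mu^{!}=a_1!a_2!\cdots$ and $\mathbf{m}_\mu=\frac{1}{(\dim\mathcal{N}_\mu)\,\mu^{!}}\sum_{\lambda(\mathbf{A})=\mu}m_{\mathbf{A}}$ (taken to be $0$ when $\mathcal{N}_\mu=0$). $\Lambda$ is the span of all $\mathbf{m}_\mu$, which is the space of invariants of the place-action. *)

theory Defs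
  imports
    Complex_Main
    "HOL-Library.Function_Algebras"
    "HOL-Library.Disjoint_Sets"
    "HOL-Library.Multiset"
    "HOL-Library.Extended_Nat"
begin

section \<open>Vector spaces of scalar-valued functions\<close>

definition fscale :: "'k::field \<Rightarrow> ('w \<Rightarrow> 'k) \<Rightarrow> ('w \<Rightarrow> 'k)" where
  "fscale c f = (\<lambda>w. c * f w)"

interpretation fs: vector_space "fscale :: 'k::field \<Rightarrow> ('w \<Rightarrow> 'k) \<Rightarrow> ('w \<Rightarrow> 'k)"
  by unfold_locales (auto simp: fscale_def fun_eq_iff algebra_simps)

definition linear_iso_betw ::
  "(('v \<Rightarrow> 'k::field) \<Rightarrow> ('w \<Rightarrow> 'k)) \<Rightarrow> ('v \<Rightarrow> 'k) set \<Rightarrow> ('w \<Rightarrow> 'k) set \<Rightarrow> bool" where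
  "linear_iso_betw \<phi> V W \<longleftrightarrow>
     (\<forall>f\<in>V. \<forall>g\<in>V. \<phi> (f + g) = \<phi> f + \<phi> g) \<and>
     (\<forall>c. \<forall>f\<in>V. \<phi> (fscale c f) = fscale c (\<phi> f)) \<and>
     bij_betw \<phi> V W"


section \<open>Noncommutative series, graded by degree\<close>

text \<open>
  The variables are indexed by the naturals \<open>i\<close> with \<open>enat i < n\<close>. A monomial
  \<open>z\<^sub>1 \<cdots> z\<^sub>d\<close> is the list of the indices of its letters, and a series is its
  coefficient function on lists. Bounding the degree gives the free algebra when \<open>n\<close> is finite
  and the formal series of bounded degree when \<open>n = \<infinity>\<close>.
\<close>

definition monomials :: "enat \<Rightarrow> nat list set" where
  "monomials n = {w. \<forall>x\<in>set w. enat x < n}"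

definition nc_series :: "enat \<Rightarrow> (nat list \<Rightarrow> 'k::field) set" where
  "nc_series n = {f. (\<forall>w. f w \<noteq> 0 \<longrightarrow> w \<in> monomials n) \<and> (\<exists>D. \<forall>w. f w \<noteq> 0 \<longrightarrow> length w \<le> D)}"

definition homogeneous_component :: "nat \<Rightarrow> (nat list \<Rightarrow> 'k::field) \<Rightarrow> (nat list \<Rightarrow> 'k)" where
  "homogeneous_component d f = (\<lambda>w. if length w = d then f w else 0)"

definition degree_part :: "nat \<Rightarrow> (nat list \<Rightarrow> 'k::field) set \<Rightarrow> (nat list \<Rightarrow> 'k) set" where
  "degree_part d V = {f \<in> V. \<forall>w. f w \<noteq> 0 \<longrightarrow> length w = d}"

definition graded_subspace :: "(nat list \<Rightarrow> 'k::field) set \<Rightarrow> (nat list \<Rightarrow> 'k) set \<Rightarrow> bool" where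
  "graded_subspace C V \<longleftrightarrow>
     fs.subspace C \<and> C \<subseteq> V \<and> (\<forall>f\<in>C. \<forall>d. homogeneous_component d f \<in> C)"


section \<open>Symmetric functions in noncommuting variables\<close>

text \<open>Positions in a monomial are numbered from 1.\<close>

definition word_type :: "nat list \<Rightarrow> nat set set" where
  "word_type w = {{i \<in> {1..length w}. w ! (i - 1) = x} | x. x \<in> set w}"

definition m_fun :: "enat \<Rightarrow> nat set set \<Rightarrow> (nat list \<Rightarrow> 'k::field)" where
  "m_fun n A = (\<lambda>w. if w \<in> monomials n \<and> word_type w = A then 1 else 0)"

definition NCSym :: "enat \<Rightarrow> (nat list \<Rightarrow> 'k::field) set" where
  "NCSym n = fs.span {m_fun n A | A d. partition_on {1..d} A}"

definition shape :: "nat set set \<Rightarrow> nat multiset" where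
  "shape A = image_mset card (mset_set A)"

definition set_partitions_of_shape :: "nat multiset \<Rightarrow> nat set set set" where
  "set_partitions_of_shape \<mu> = {A. partition_on {1..sum_mset \<mu>} A \<and> shape A = \<mu>}"

definition NCSym_shape :: "enat \<Rightarrow> nat multiset \<Rightarrow> (nat list \<Rightarrow> 'k::field) set" where
  "NCSym_shape n \<mu> = fs.span (m_fun n ` set_partitions_of_shape \<mu>)"

definition mult_fact :: "nat multiset \<Rightarrow> nat" where
  "mult_fact \<mu> = (\<Prod>i\<in>set_mset \<mu>. fact (count \<mu> i))"

text \<open>
  If \<open>NCSym_shape n \<mu>\<close> is the zero space, then the coefficient below is \<open>1 / 0 = 0\<close>
  and \<open>bold_m n \<mu> = 0\<close>.
\<close>

definition bold_m :: "enat \<Rightarrow> nat multiset \<Rightarrow> (nat list \<Rightarrow> 'k::field)" where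
  "bold_m n \<mu> =
     fscale (1 / (of_nat (fs.dim (NCSym_shape n \<mu> :: (nat list \<Rightarrow> 'k) set)) * of_nat (mult_fact \<mu>)))
       (\<Sum>A\<in>set_partitions_of_shape \<mu>. m_fun n A)"

definition Lambda :: "enat \<Rightarrow> (nat list \<Rightarrow> 'k::field) set" where
  "Lambda n = fs.span {bold_m n \<mu> | \<mu>. 0 \<notin># \<mu>}"

lemma finite_set_partitions_of_shape: "finite (set_partitions_of_shape \<mu>)"
  by (rule finite_subset[of _ "Pow (Pow {1..sum_mset \<mu>})"])
     (auto simp: set_partitions_of_shape_def partition_on_def)

lemma word_type_partition_on: "partition_on {1..length w} (word_type w)"
proof (rule partition_onI)
  show "\<Union> (word_type w) = {1..length w}"
  proof
    show "{1..length w} \<subseteq> \<Union> (word_type w)"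
    proof
      fix i assume i: "i \<in> {1..length w}"
      then have "w ! (i - 1) \<in> set w" by auto
      with i show "i \<in> \<Union> (word_type w)"
        unfolding word_type_def by blast
    qed
  qed (auto simp: word_type_def)
next
  have "p \<noteq> {}" if "p \<in> word_type w" for p
  proof -
    from that obtain x where x: "x \<in> set w" "p = {i \<in> {1..length w}. w ! (i - 1) = x}"
      unfolding word_type_def by blast
    then obtain j where "j < length w" "w ! j = x" by (auto simp: in_set_conv_nth)
    then have "Suc j \<in> p" using x by auto
    then show ?thesis by blast
  qed
  then show "{} \<notin> word_type w" by blast
qed (auto simp: word_type_def disjnt_def)

lemma m_fun_empty: "m_fun n {} = (\<lambda>w. if w = [] then 1 else 0)"
proof -
  have "word_type w = {} \<longleftrightarrow> w = []" for w
    by (cases w) (auto simp: word_type_def)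
  then show ?thesis by (auto simp: m_fun_def monomials_def fun_eq_iff)
qed

lemma m_fun_nc_series:
  assumes "partition_on {1..d} A"
  shows "m_fun n A \<in> (nc_series n :: (nat list \<Rightarrow> 'k::field) set)"
proof -
  have "length w = d" if "word_type w = A" for w
  proof -
    have "{1..length w} = {1..d}"
      using word_type_partition_on[of w] assms that by (simp add: partition_on_def)
    then show ?thesis by (metis card_atLeastAtMost diff_Suc_1)
  qed
  then show ?thesis by (auto simp: nc_series_def m_fun_def)
qed

lemma subspace_nc_series: "fs.subspace (nc_series n :: (nat list \<Rightarrow> 'k::field) set)"
proof (rule fs.subspaceI)
  fix f g :: "nat list \<Rightarrow> 'k" assume "f \<in> nc_series n" "g \<in> nc_series n"
  then obtain D E where *: "\<forall>w. f w \<noteq> 0 \<longrightarrow> w \<in> monomials n \<and> length w \<le> D"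
    "\<forall>w. g w \<noteq> 0 \<longrightarrow> w \<in> monomials n \<and> length w \<le> E"
    unfolding nc_series_def by blast
  have "w \<in> monomials n \<and> length w \<le> max D E" if "f w + g w \<noteq> 0" for w
  proof (cases "f w = 0")
    case True
    with that *(2) show ?thesis by (auto simp: le_max_iff_disj)
  next
    case False
    with *(1) show ?thesis by (auto simp: le_max_iff_disj)
  qed
  then show "f + g \<in> nc_series n" unfolding nc_series_def by auto
qed (auto simp: nc_series_def fscale_def)

lemma NCSym_subset_nc_series: "NCSym n \<subseteq> (nc_series n :: (nat list \<Rightarrow> 'k::field) set)"
  unfolding NCSym_def
  by (rule fs.span_minimal) (auto intro: m_fun_nc_series subspace_nc_series)

lemma Lambda_subset_NCSym: "Lambda n \<subseteq> (NCSym n :: (nat list \<Rightarrow> 'k::field) set)"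
  unfolding Lambda_def
proof (rule fs.span_minimal)
  show "fs.subspace (NCSym n :: (nat list \<Rightarrow> 'k) set)"
    unfolding NCSym_def by (rule fs.subspace_span)
  have "bold_m n \<mu> \<in> (NCSym n :: (nat list \<Rightarrow> 'k) set)" for \<mu>
    unfolding bold_m_def NCSym_def
    by (intro fs.span_scale fs.span_sum fs.span_base) (auto simp: set_partitions_of_shape_def)
  then show "{bold_m n \<mu> | \<mu>. 0 \<notin># \<mu>} \<subseteq> (NCSym n :: (nat list \<Rightarrow> 'k) set)" by blast
qed


section \<open>Tensor products\<close>

text \<open>
  The tensor product of two spaces of scalar-valued functions is realised inside the functions
  of two arguments, with \<open>(f \<otimes> g) (u, v) = f u * g v\<close>. The lemmas
  \<open>tensor_space_universal\<close> and \<open>tensor_space_unique\<close> show that this model has the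
  universal property of the tensor product.
\<close>

definition pure_tensor ::
  "('v \<Rightarrow> 'k::field) \<Rightarrow> ('w \<Rightarrow> 'k) \<Rightarrow> ('v \<times> 'w \<Rightarrow> 'k)" where
  "pure_tensor f g = (\<lambda>(u, v). f u * g v)"

definition tensor_space ::
  "('v \<Rightarrow> 'k::field) set \<Rightarrow> ('w \<Rightarrow> 'k) set \<Rightarrow> ('v \<times> 'w \<Rightarrow> 'k) set" where
  "tensor_space V W = fs.span {pure_tensor f g | f g. f \<in> V \<and> g \<in> W}"

definition tensor_degree_part ::
  "nat \<Rightarrow> (nat list \<Rightarrow> 'k::field) set \<Rightarrow> (nat list \<Rightarrow> 'k) set
    \<Rightarrow> (nat list \<times> nat list \<Rightarrow> 'k) set" where
  "tensor_degree_part d V W =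
     fs.span {pure_tensor f g | f g i j. i + j = d \<and> f \<in> degree_part i V \<and> g \<in> degree_part j W}"

lemma pure_tensor_sum_eq_0:
  fixes a :: "('v \<Rightarrow> 'k::field) \<times> ('w \<Rightarrow> 'k) \<Rightarrow> 'k"
  assumes B: "fs.independent B" and D: "fs.independent D"
    and F: "finite F" "F \<subseteq> B" and G: "finite G" "G \<subseteq> D"
    and 0: "(\<Sum>b\<in>F. \<Sum>d\<in>G. fscale (a (b, d)) (pure_tensor b d)) = 0"
    and bd: "b \<in> F" "d \<in> G"
  shows "a (b, d) = 0"
proof -
  have sum_app: "(\<Sum>x\<in>X. h x) y = (\<Sum>x\<in>X. h x y)"
    for X :: "'x set" and h :: "'x \<Rightarrow> 'y \<Rightarrow> 'k" and y
    by (induction X rule: infinite_finite_induct) auto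
  have *: "(\<Sum>b\<in>F. a (b, d) * b u) = 0" if "d \<in> G" for u d
  proof -
    have "(\<Sum>d\<in>G. fscale (\<Sum>b\<in>F. a (b, d) * b u) d) = 0"
    proof
      fix v
      have "(\<Sum>d\<in>G. fscale (\<Sum>b\<in>F. a (b, d) * b u) d) v
          = (\<Sum>d\<in>G. \<Sum>b\<in>F. a (b, d) * (b u * d v))"
        by (simp add: sum_app fscale_def sum_distrib_right mult.assoc)
      also have "\<dots> = (\<Sum>b\<in>F. \<Sum>d\<in>G. a (b, d) * (b u * d v))"
        by (rule sum.swap)
      also have "\<dots> = (\<Sum>b\<in>F. \<Sum>d\<in>G. fscale (a (b, d)) (pure_tensor b d)) (u, v)"
        by (simp add: sum_app fscale_def pure_tensor_def)
      finally show "(\<Sum>d\<in>G. fscale (\<Sum>b\<in>F. a (b, d) * b u) d) v = 0 v"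
        by (simp add: 0)
    qed
    then show ?thesis
      by (rule fs.independentD[OF D G]) (rule that)
  qed
  have "(\<Sum>b\<in>F. fscale (a (b, d)) b) = 0"
    by (rule ext) (simp add: sum_app fscale_def * bd)
  then show ?thesis by (rule fs.independentD[OF B F]) (rule bd)
qed

lemma pure_tensor_basis:
  fixes B :: "('v \<Rightarrow> 'k::field) set" and D :: "('w \<Rightarrow> 'k) set"
  assumes B: "fs.independent B" and D: "fs.independent D"
  shows "inj_on (\<lambda>(b, d). pure_tensor b d) (B \<times> D)"
    and "fs.independent ((\<lambda>(b, d). pure_tensor b d) ` (B \<times> D))"
proof -
  let ?t = "\<lambda>(b, d). pure_tensor b d :: 'v \<times> 'w \<Rightarrow> 'k"
  have key: "a p = 0"
    if S: "finite S" "S \<subseteq> B \<times> D" and 0: "(\<Sum>p\<in>S. fscale (a p) (?t p)) = 0" and p: "p \<in> S"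
    for a S p
  proof -
    let ?a = "\<lambda>p. if p \<in> S then a p else 0"
    have "(\<Sum>b\<in>fst ` S. \<Sum>d\<in>snd ` S. fscale (?a (b, d)) (pure_tensor b d))
        = (\<Sum>p\<in>fst ` S \<times> snd ` S. fscale (?a p) (?t p))"
      by (simp only: sum.cartesian_product) (auto intro!: sum.cong)
    also have "\<dots> = (\<Sum>p\<in>S. fscale (a p) (?t p))"
      using S by (intro sum.mono_neutral_cong_right) (auto simp: fscale_def fun_eq_iff image_iff, force+)
    finally have 1: "(\<Sum>b\<in>fst ` S. \<Sum>d\<in>snd ` S. fscale (?a (b, d)) (pure_tensor b d)) = 0"
      using 0 by simp
    have "?a (fst p, snd p) = 0"
      by (rule pure_tensor_sum_eq_0[OF B D _ _ _ _ 1]) (use S p in auto)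
    then show ?thesis using p by simp
  qed
  show inj: "inj_on ?t (B \<times> D)"
  proof (rule inj_onI, rule ccontr)
    fix p q assume pq: "p \<in> B \<times> D" "q \<in> B \<times> D" "?t p = ?t q" "p \<noteq> q"
    let ?a = "\<lambda>r. if r = p then 1 else -1 :: 'k"
    have "(\<Sum>r\<in>{p, q}. fscale (?a r) (?t r)) = 0"
      using pq by (auto simp: fscale_def fun_eq_iff)
    from key[OF _ _ this, of p] pq show False by auto
  qed
  show "fs.independent (?t ` (B \<times> D))"
    unfolding fs.independent_explicit_finite_subsets
  proof (intro allI impI ballI)
    fix S u x
    assume S: "S \<subseteq> ?t ` (B \<times> D)" "finite S" and 0: "(\<Sum>v\<in>S. fscale (u v) v) = 0" and x: "x \<in> S"
    from S obtain R where R: "R \<subseteq> B \<times> D" "finite R" "S = ?t ` R"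
      by (meson finite_subset_image)
    have "inj_on ?t R" using inj R(1) by (rule inj_on_subset)
    then have "(\<Sum>p\<in>R. fscale ((u \<circ> ?t) p) (?t p)) = 0"
      using 0 by (simp add: R(3) sum.reindex comp_def)
    from key[OF R(2,1) this] x R(3) show "u x = 0" by auto
  qed
qed

lemma pure_tensor_bilinear:
  "pure_tensor (f + f') g = pure_tensor f g + pure_tensor f' g"
  "pure_tensor f (g + g') = pure_tensor f g + pure_tensor f g'"
  "pure_tensor (fscale c f) g = fscale c (pure_tensor f g)"
  "pure_tensor f (fscale c g) = fscale c (pure_tensor f g)"
  by (auto simp: pure_tensor_def fscale_def fun_eq_iff algebra_simps)

lemma tensor_space_universal:
  fixes V :: "('v \<Rightarrow> 'k::field) set" and W :: "('w \<Rightarrow> 'k) set"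
    and scale :: "'k \<Rightarrow> 'x::ab_group_add \<Rightarrow> 'x"
    and \<beta> :: "('v \<Rightarrow> 'k) \<Rightarrow> ('w \<Rightarrow> 'k) \<Rightarrow> 'x"
  assumes "vector_space scale" and V: "fs.subspace V" and W: "fs.subspace W"
    and add1: "\<And>f f' g. f \<in> V \<Longrightarrow> f' \<in> V \<Longrightarrow> g \<in> W \<Longrightarrow> \<beta> (f + f') g = \<beta> f g + \<beta> f' g"
    and add2: "\<And>f g g'. f \<in> V \<Longrightarrow> g \<in> W \<Longrightarrow> g' \<in> W \<Longrightarrow> \<beta> f (g + g') = \<beta> f g + \<beta> f g'"
    and sc1: "\<And>c f g. f \<in> V \<Longrightarrow> g \<in> W \<Longrightarrow> \<beta> (fscale c f) g = scale c (\<beta> f g)"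
    and sc2: "\<And>c f g. f \<in> V \<Longrightarrow> g \<in> W \<Longrightarrow> \<beta> f (fscale c g) = scale c (\<beta> f g)"
  obtains L where "Vector_Spaces.linear fscale scale L"
    and "\<And>f g. f \<in> V \<Longrightarrow> g \<in> W \<Longrightarrow> L (pure_tensor f g) = \<beta> f g"
proof -
  interpret X: vector_space scale by fact
  interpret vp: vector_space_pair "fscale :: 'k \<Rightarrow> ('v \<times> 'w \<Rightarrow> 'k) \<Rightarrow> _" scale ..
  let ?t = "\<lambda>(b, d). pure_tensor b d :: 'v \<times> 'w \<Rightarrow> 'k"
  obtain B where B: "B \<subseteq> V" "fs.independent B" "V \<subseteq> fs.span B"
    using fs.maximal_independent_subset by blast
  obtain D where D: "D \<subseteq> W" "fs.independent D" "W \<subseteq> fs.span D"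
    using fs.maximal_independent_subset by blast
  have BV: "fs.span B = V" and DW: "fs.span D = W"
    using B D V W by (auto dest: fs.span_subspace)
  note tb = pure_tensor_basis[OF B(2) D(2)]
  define L where
    "L = vp.construct (?t ` (B \<times> D)) (\<lambda>x. case inv_into (B \<times> D) ?t x of (b, d) \<Rightarrow> \<beta> b d)"
  have L: "Vector_Spaces.linear fscale scale L"
    unfolding L_def by (rule vp.linear_construct[OF tb(2)])
  interpret L: Vector_Spaces.linear fscale scale L by (rule L)
  have on_basis: "L (pure_tensor b d) = \<beta> b d" if "b \<in> B" "d \<in> D" for b d
  proof -
    have "pure_tensor b d \<in> ?t ` (B \<times> D)" using that by force
    moreover have "inv_into (B \<times> D) ?t (pure_tensor b d) = (b, d)"
      using inv_into_f_f[OF tb(1), of "(b, d)"] that by simp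
    ultimately show ?thesis
      unfolding L_def using vp.construct_basis[OF tb(2)] by simp
  qed
  have zero1: "\<beta> 0 g = 0" if "g \<in> W" for g
    using add1[of 0 0 g] fs.subspace_0[OF V] that by simp
  have zero2: "\<beta> f 0 = 0" if "f \<in> V" for f
    using add2[of f 0 0] fs.subspace_0[OF W] that by simp
  have pt0: "pure_tensor 0 g = 0" "pure_tensor f 0 = 0"
    for f :: "'v \<Rightarrow> 'k" and g :: "'w \<Rightarrow> 'k"
    by (auto simp: pure_tensor_def fun_eq_iff)
  have on_left: "L (pure_tensor b g) = \<beta> b g" if b: "b \<in> B" and g: "g \<in> fs.span D" for b g
  proof -
    have bV: "b \<in> V" using b B(1) by blast
    from g have "g \<in> W \<and> L (pure_tensor b g) = \<beta> b g"
    proof (induction rule: fs.span_induct_alt)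
      case base
      show ?case using bV fs.subspace_0[OF W] by (simp only: pt0 zero2 L.zero simp_thms)
    next
      case (step c x y)
      have *: "x \<in> W" "fscale c x \<in> W" "y \<in> W"
        using step D(1) fs.subspace_scale[OF W] by auto
      have "L (pure_tensor b (fscale c x + y)) = scale c (L (pure_tensor b x)) + L (pure_tensor b y)"
        by (simp only: pure_tensor_bilinear L.add L.scale)
      also have "\<dots> = scale c (\<beta> b x) + \<beta> b y"
        using step on_basis b by simp
      also have "\<dots> = \<beta> b (fscale c x + y)"
        by (simp only: add2 sc2 * bV)
      finally show ?case using fs.subspace_add[OF W *(2,3)] by blast
    qed
    then show ?thesis by blast
  qed
  have "L (pure_tensor f g) = \<beta> f g" if f: "f \<in> fs.span B" and g: "g \<in> W" for f g
  proof -
    from f have "f \<in> V \<and> L (pure_tensor f g) = \<beta> f g"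
    proof (induction rule: fs.span_induct_alt)
      case base
      show ?case using g fs.subspace_0[OF V] by (simp only: pt0 zero1 L.zero simp_thms)
    next
      case (step c x y)
      have *: "x \<in> V" "fscale c x \<in> V" "y \<in> V"
        using step B(1) fs.subspace_scale[OF V] by auto
      have "L (pure_tensor (fscale c x + y) g) = scale c (L (pure_tensor x g)) + L (pure_tensor y g)"
        by (simp only: pure_tensor_bilinear L.add L.scale)
      also have "\<dots> = scale c (\<beta> x g) + \<beta> y g"
        using step on_left g DW by simp
      also have "\<dots> = \<beta> (fscale c x + y) g"
        by (simp only: add1 sc1 * g)
      finally show ?case using fs.subspace_add[OF V *(2,3)] by blast
    qed
    then show ?thesis by blast
  qed
  with L BV show thesis by (intro that[of L]) auto
qed

lemma tensor_space_unique:
  assumes L: "Vector_Spaces.linear fscale scale L" and L': "Vector_Spaces.linear fscale scale L'"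
    and eq: "\<And>f g. f \<in> V \<Longrightarrow> g \<in> W \<Longrightarrow> L (pure_tensor f g) = L' (pure_tensor f g)"
    and x: "x \<in> tensor_space V W"
  shows "L x = L' x"
proof -
  interpret L: Vector_Spaces.linear fscale scale L by (rule L)
  interpret vp: vector_space_pair fscale scale ..
  show ?thesis
    by (rule vp.linear_eq_on[OF L L' x[unfolded tensor_space_def]]) (use eq in auto)
qed

end

theory Submission
  imports Defs "HOL-Computational_Algebra.Formal_Power_Series"
begin

text \<open>
  The functions \<open>m_fun n A\<close> with at most \<open>n\<close> blocks and the functions \<open>bold_m n \<mu>\<close> with at most
  \<open>n\<close> parts have pairwise disjoint supports, so they are homogeneous bases. The Hilbert series are
  therefore \<open>F\<^sub>n = \<Sum>k\<le>n. t^k / ((1 - t) \<dots> (1 - k t))\<close> for \<open>NCSym\<close> and \<open>1 / P\<^sub>n\<close> with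
  \<open>P\<^sub>n = (1 - t) \<dots> (1 - t^n)\<close> for \<open>Lambda\<close>, and the theorem reduces to the nonnegativity of the
  coefficients of \<open>G\<^sub>n = P\<^sub>n F\<^sub>n\<close>: any choice of \<open>G\<^sub>n $ i\<close> basis elements of \<open>NCSym\<close> in each degree
  \<open>i\<close> spans a suitable \<open>C\<close>.

  With \<open>Q\<^sub>n = \<Prod>i=1..n. (1 - t^i) / (1 - i t)\<close> one has \<open>G\<^sub>n = G\<^sub>n\<^sub>-\<^sub>1 + t^n (Q\<^sub>n - G\<^sub>n\<^sub>-\<^sub>1)\<close>. If
  \<open>0 \<le> G\<^sub>n\<^sub>-\<^sub>1 \<le> Q\<^sub>n\<close> coefficientwise, then \<open>0 \<le> G\<^sub>n \<le> (1 + t^n) Q\<^sub>n \<le> Q\<^sub>n\<^sub>+\<^sub>1\<close>, since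
  \<open>(1 - t^(n+1)) / (1 - (n+1) t)\<close> dominates \<open>1 + t^n\<close>. The case \<open>n = \<infinity>\<close> follows because in
  degrees at most \<open>d\<close> it agrees with the case \<open>n = d\<close>.
\<close>

unbundle fps_syntax


section \<open>Graded tensor decompositions from homogeneous bases\<close>

lemma homogeneous_component_linear:
  "Vector_Spaces.linear fscale fscale (homogeneous_component d :: (nat list \<Rightarrow> 'k::field) \<Rightarrow> _)"
  by unfold_locales (auto simp: homogeneous_component_def fscale_def fun_eq_iff algebra_simps)

text \<open>The projection to degree \<open>d\<close> is linear and sends each generator to itself
  or to 0.\<close>

lemma homogeneous_component_in_span:
  fixes B :: "nat \<Rightarrow> (nat list \<Rightarrow> 'k::field) set"
  assumes hom: "\<And>d b w. b \<in> B d \<Longrightarrow> b w \<noteq> 0 \<Longrightarrow> length w = d"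
    and f: "f \<in> fs.span (\<Union>i. B i)"
  shows "homogeneous_component d f \<in> fs.span (B d)"
proof -
  interpret h: Vector_Spaces.linear fscale fscale "homogeneous_component d :: (nat list \<Rightarrow> 'k) \<Rightarrow> _"
    by (rule homogeneous_component_linear)
  have gen: "homogeneous_component d b \<in> fs.span (B d)" if "b \<in> (\<Union>i. B i)" for b
  proof -
    obtain i where i: "b \<in> B i" using \<open>b \<in> (\<Union>i. B i)\<close> by blast
    have "homogeneous_component d b = (if i = d then b else 0)"
      using hom[OF i] by (auto simp: homogeneous_component_def fun_eq_iff)
    with i show ?thesis by (auto intro: fs.span_base fs.span_zero)
  qed
  from f show ?thesis
  proof (induction rule: fs.span_induct_alt)
    case base
    show ?case by (simp only: h.zero fs.span_zero)
  next
    case (step c x y)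
    then show ?case
      unfolding h.add h.scale by (blast intro: fs.span_add fs.span_scale gen)
  qed
qed

text \<open>A vector supported in degree \<open>d\<close> is its own homogeneous component, so the
  projection places it in the span of \<open>B d\<close>.\<close>

lemma degree_part_span:
  fixes B :: "nat \<Rightarrow> (nat list \<Rightarrow> 'k::field) set"
  assumes hom: "\<And>d b w. b \<in> B d \<Longrightarrow> b w \<noteq> 0 \<Longrightarrow> length w = d"
  shows "degree_part d (fs.span (\<Union>i. B i)) = fs.span (B d)"
proof
  show "degree_part d (fs.span (\<Union>i. B i)) \<subseteq> fs.span (B d)"
  proof
    fix f assume f: "f \<in> degree_part d (fs.span (\<Union>i. B i))"
    then have "homogeneous_component d f = f"
      by (auto simp: degree_part_def homogeneous_component_def fun_eq_iff)
    then show "f \<in> fs.span (B d)"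
      using homogeneous_component_in_span[of B f d, OF hom] f by (simp add: degree_part_def)
  qed
  show "fs.span (B d) \<subseteq> degree_part d (fs.span (\<Union>i. B i))"
  proof (rule fs.span_minimal)
    show "B d \<subseteq> degree_part d (fs.span (\<Union>i. B i))"
      using hom by (auto simp: degree_part_def intro: fs.span_base)
    show "fs.subspace (degree_part d (fs.span (\<Union>i. B i)))"
    proof (rule fs.subspaceI)
      fix f g assume fg: "f \<in> degree_part d (fs.span (\<Union>i. B i))" "g \<in> degree_part d (fs.span (\<Union>i. B i))"
      have "f w \<noteq> 0 \<or> g w \<noteq> 0" if "(f + g) w \<noteq> 0" for w
        using that by auto
      with fg show "f + g \<in> degree_part d (fs.span (\<Union>i. B i))"
        by (auto simp: degree_part_def intro: fs.span_add simp del: plus_fun_apply)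
    next
      fix c f assume f: "f \<in> degree_part d (fs.span (\<Union>i. B i))"
      have "f w \<noteq> 0" if "fscale c f w \<noteq> 0" for w
        using that by (auto simp: fscale_def)
      with f show "fscale c f \<in> degree_part d (fs.span (\<Union>i. B i))"
        by (auto simp: degree_part_def intro: fs.span_scale)
    qed (auto simp: degree_part_def intro: fs.span_zero)
  qed
qed

text \<open>Bilinearity allows a span induction in the second argument and then one in the
  first.\<close>

lemma pure_tensor_in_span:
  assumes f: "f \<in> fs.span B" and g: "g \<in> fs.span D"
  shows "pure_tensor f g \<in> fs.span ((\<lambda>(b, d). pure_tensor b d) ` (B \<times> D))" (is "_ \<in> ?S")
proof -
  have zero: "pure_tensor 0 h = 0" "pure_tensor h' 0 = 0" for h h'
    by (auto simp: pure_tensor_def fun_eq_iff)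
  have 1: "pure_tensor b g \<in> ?S" if "b \<in> B" for b
    using g
  proof (induction rule: fs.span_induct_alt)
    case base
    show ?case by (simp only: zero fs.span_zero)
  next
    case (step c x y)
    have "pure_tensor b x \<in> ?S" using step that by (auto intro: fs.span_base)
    with step show ?case
      by (simp only: pure_tensor_bilinear) (intro fs.span_add fs.span_scale)
  qed
  from f show ?thesis
  proof (induction rule: fs.span_induct_alt)
    case base
    show ?case by (simp only: zero fs.span_zero)
  next
    case (step c x y)
    with 1 show ?case
      by (simp only: pure_tensor_bilinear) (intro fs.span_add fs.span_scale)
  qed
qed

lemma tensor_space_span:
  "tensor_space (fs.span B) (fs.span D) = fs.span ((\<lambda>(b, d). pure_tensor b d) ` (B \<times> D))"
proof
  show "tensor_space (fs.span B) (fs.span D) \<subseteq> fs.span ((\<lambda>(b, d). pure_tensor b d) ` (B \<times> D))"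
    unfolding tensor_space_def
    by (rule fs.span_minimal) (auto intro: pure_tensor_in_span fs.subspace_span)
  show "fs.span ((\<lambda>(b, d). pure_tensor b d) ` (B \<times> D)) \<subseteq> tensor_space (fs.span B) (fs.span D)"
    unfolding tensor_space_def by (rule fs.span_mono) (auto intro: fs.span_base)
qed

lemma tensor_degree_part_span:
  fixes B D :: "nat \<Rightarrow> (nat list \<Rightarrow> 'k::field) set"
  assumes B: "\<And>d b w. b \<in> B d \<Longrightarrow> b w \<noteq> 0 \<Longrightarrow> length w = d"
    and D: "\<And>d b w. b \<in> D d \<Longrightarrow> b w \<noteq> 0 \<Longrightarrow> length w = d"
  shows "tensor_degree_part d (fs.span (\<Union>i. B i)) (fs.span (\<Union>i. D i)) =
    fs.span ((\<lambda>(b, d). pure_tensor b d) ` (\<Union>i\<le>d. B i \<times> D (d - i)))" (is "?L = fs.span ?R")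
proof
  note dp = degree_part_span[of B, OF B] degree_part_span[of D, OF D]
  show "?L \<subseteq> fs.span ?R"
    unfolding tensor_degree_part_def
  proof (rule fs.span_minimal)
    show "{pure_tensor f g |f g i j. i + j = d \<and> f \<in> degree_part i (fs.span (\<Union>i. B i)) \<and>
        g \<in> degree_part j (fs.span (\<Union>i. D i))} \<subseteq> fs.span ?R"
    proof clarify
      fix f g i j
      assume "d = i + j"
        and fg: "f \<in> degree_part i (fs.span (\<Union>i. B i))" "g \<in> degree_part j (fs.span (\<Union>i. D i))"
      then have "(\<lambda>(b, d). pure_tensor b d) ` (B i \<times> D j)
          \<subseteq> (\<lambda>(b, d). pure_tensor b d) ` (\<Union>k\<le>i + j. B k \<times> D (i + j - k))"
        by (intro image_mono) fastforce
      moreover have "pure_tensor f g \<in> fs.span ((\<lambda>(b, d). pure_tensor b d) ` (B i \<times> D j))"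
        using fg by (intro pure_tensor_in_span) (simp_all add: dp B D)
      ultimately show "pure_tensor f g \<in>
          fs.span ((\<lambda>(b, d). pure_tensor b d) ` (\<Union>k\<le>i + j. B k \<times> D (i + j - k)))"
        using fs.span_mono by blast
    qed
  qed (rule fs.subspace_span)
  show "fs.span ?R \<subseteq> ?L"
    unfolding tensor_degree_part_def
  proof (rule fs.span_mono, clarify)
    fix b e i assume "i \<le> d" "b \<in> B i" "e \<in> D (d - i)"
    then show "\<exists>f g j k. pure_tensor b e = pure_tensor f g \<and> j + k = d \<and>
        f \<in> degree_part j (fs.span (\<Union>i. B i)) \<and> g \<in> degree_part k (fs.span (\<Union>i. D i))"
      by (intro exI[of _ b] exI[of _ e] exI[of _ i] exI[of _ "d - i"])
         (simp add: dp B D fs.span_base)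
  qed
qed

text \<open>Independence excludes the zero vector, and a nonzero homogeneous vector has only one
  degree.\<close>

lemma homogeneous_family_disjoint:
  fixes B :: "nat \<Rightarrow> (nat list \<Rightarrow> 'k::field) set"
  assumes hom: "\<And>d b w. b \<in> B d \<Longrightarrow> b w \<noteq> 0 \<Longrightarrow> length w = d"
    and indep: "fs.independent (\<Union>d. B d)"
  shows "disjoint_family B"
proof -
  have "i = j" if b: "b \<in> B i" "b \<in> B j" for b i j
  proof -
    have "b \<noteq> 0" using b indep fs.dependent_zero by blast
    then obtain w where "b w \<noteq> 0" by (auto simp: fun_eq_iff)
    then show ?thesis using hom b by metis
  qed
  then show ?thesis by (auto simp: disjoint_family_on_def)
qed

text \<open>The assumption \<open>card\<close> is a factorization of Hilbert series. Any
  \<open>c i\<close> elements chosen from each \<open>B i\<close> span a suitable \<open>C\<close>: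
  in every degree there are as many pure tensors of basis elements as elements of
  \<open>B d\<close>, and a matching of the two bases extends linearly.\<close>

lemma graded_tensor_decomposition:
  fixes B L :: "nat \<Rightarrow> (nat list \<Rightarrow> 'k::field) set" and c :: "nat \<Rightarrow> nat"
  assumes homB: "\<And>d b w. b \<in> B d \<Longrightarrow> b w \<noteq> 0 \<Longrightarrow> length w = d"
    and homL: "\<And>d b w. b \<in> L d \<Longrightarrow> b w \<noteq> 0 \<Longrightarrow> length w = d"
    and indepB: "fs.independent (\<Union>d. B d)" and indepL: "fs.independent (\<Union>d. L d)"
    and finB: "\<And>d. finite (B d)" and finL: "\<And>d. finite (L d)"
    and card: "\<And>d. card (B d) = (\<Sum>i\<le>d. c i * card (L (d - i)))"
    and L0: "L 0 \<noteq> {}"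
  shows "\<exists>C (\<phi> :: (nat list \<Rightarrow> 'k) \<Rightarrow> (nat list \<times> nat list \<Rightarrow> 'k)).
           graded_subspace C (fs.span (\<Union>d. B d)) \<and>
           linear_iso_betw \<phi> (fs.span (\<Union>d. B d)) (tensor_space C (fs.span (\<Union>d. L d))) \<and>
           (\<forall>d. \<phi> ` degree_part d (fs.span (\<Union>d. B d)) =
                tensor_degree_part d C (fs.span (\<Union>d. L d)))"
proof -
  let ?pt = "\<lambda>(b, d). pure_tensor b d :: nat list \<times> nat list \<Rightarrow> 'k"
  have "\<exists>Y. Y \<subseteq> B i \<and> card Y = c i" for i
  proof -
    \<comment> \<open>The right-hand side is the summand \<open>i\<close> of the convolution for
      \<open>card (B i)\<close>; its second factor is positive because \<open>L 0\<close> is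
      nonempty.\<close>
    have "c i \<le> c i * card (L (i - i))"
      using L0 finL[of 0] by (simp add: Suc_le_eq card_gt_0_iff)
    also have "\<dots> \<le> card (B i)"
      unfolding card by (rule member_le_sum) auto
    finally show ?thesis
      by (meson obtain_subset_with_card_n)
  qed
  then obtain Y where YB: "\<And>i. Y i \<subseteq> B i" and cardY: "\<And>i. card (Y i) = c i"
    by metis
  have homY: "\<And>d b w. b \<in> Y d \<Longrightarrow> b w \<noteq> 0 \<Longrightarrow> length w = d"
    using homB YB by blast
  have UYB: "(\<Union>i. Y i) \<subseteq> (\<Union>i. B i)" using YB by blast
  have indepY: "fs.independent (\<Union>i. Y i)"
    by (rule fs.independent_mono[OF indepB UYB])
  have finY: "finite (Y i)" for i using YB finB finite_subset by blast
  have disB: "disjoint_family B" by (rule homogeneous_family_disjoint[OF homB indepB])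
  have disY: "disjoint_family Y" by (rule homogeneous_family_disjoint[OF homY indepY])
  have disL: "disjoint_family L" by (rule homogeneous_family_disjoint[OF homL indepL])
  \<comment> \<open>Index pairs of the pure tensors of total degree \<open>d\<close>.\<close>
  define T where "T d = (\<Union>i\<le>d. Y i \<times> L (d - i))" for d
  have UT: "(\<Union>d. T d) = (\<Union>i. Y i) \<times> (\<Union>i. L i)"
  proof
    show "(\<Union>i. Y i) \<times> (\<Union>i. L i) \<subseteq> (\<Union>d. T d)"
    proof clarify
      fix y l i j assume "y \<in> Y i" "l \<in> L j"
      then have "(y, l) \<in> T (i + j)" by (auto simp: T_def intro!: bexI[of _ i])
      then show "(y, l) \<in> (\<Union>d. T d)" by blast
    qed
  qed (auto simp: T_def)
  have disT: "disjoint_family T"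
  proof -
    have "d = e" if p: "p \<in> T d" "p \<in> T e" for p d e
    proof -
      obtain i where "i \<le> d" "fst p \<in> Y i" "snd p \<in> L (d - i)"
        using p(1) by (auto simp: T_def)
      moreover obtain j where "j \<le> e" "fst p \<in> Y j" "snd p \<in> L (e - j)"
        using p(2) by (auto simp: T_def)
      moreover from calculation have "i = j" "d - i = e - j"
        using disY disL unfolding disjoint_family_on_def by blast+
      ultimately show ?thesis by simp
    qed
    then show ?thesis by (auto simp: disjoint_family_on_def)
  qed
  have cardT: "card (T d) = card (B d)" for d
  proof -
    have "card (T d) = (\<Sum>i\<le>d. card (Y i \<times> L (d - i)))"
      unfolding T_def
      using disY by (intro card_UN_disjoint) (auto simp: finY finL disjoint_family_on_def)
    then show ?thesis by (simp add: card_cartesian_product cardY card)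
  qed
  have "finite (T d)" for d by (simp add: T_def finY finL)
  then have "\<forall>d. \<exists>h. bij_betw h (B d) (T d)"
    using finite_same_card_bij finB cardT by metis
  then obtain h where h: "\<And>d. bij_betw (h d) (B d) (T d)" by metis
  \<comment> \<open>The sets \<open>B d\<close> are disjoint, so each basis vector has one degree
    and the bijections \<open>h d\<close> glue to a single map.\<close>
  define \<psi> where "\<psi> b = h (THE d. b \<in> B d) b" for b
  have "\<psi> b = h d b" if "b \<in> B d" for b d
  proof -
    have "(THE d. b \<in> B d) = d"
      using that disB by (intro the_equality) (auto simp: disjoint_family_on_def)
    then show ?thesis by (simp add: \<psi>_def)
  qed
  then have \<psi>: "bij_betw \<psi> (B d) (T d)" for d
    using h[of d] by (simp cong: bij_betw_cong)
  have \<psi>U: "bij_betw \<psi> (\<Union>d. B d) (\<Union>d. T d)"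
    by (rule bij_betw_UNION_disjoint[OF disT \<psi>])
  interpret vp: vector_space_pair "fscale :: 'k \<Rightarrow> (nat list \<Rightarrow> 'k) \<Rightarrow> _"
    "fscale :: 'k \<Rightarrow> (nat list \<times> nat list \<Rightarrow> 'k) \<Rightarrow> _" ..
  note tb = pure_tensor_basis[OF indepY indepL, folded UT]
  define \<phi> where "\<phi> = vp.construct (\<Union>d. B d) (?pt \<circ> \<psi>)"
  have lin: "Vector_Spaces.linear fscale fscale \<phi>"
    unfolding \<phi>_def by (rule vp.linear_construct[OF indepB])
  interpret \<phi>: Vector_Spaces.linear fscale fscale \<phi> by (rule lin)
  have \<phi>_basis: "\<phi> b = ?pt (\<psi> b)" if "b \<in> (\<Union>d. B d)" for b
    unfolding \<phi>_def using vp.construct_basis[OF indepB that] by simp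
  have \<phi>_image: "\<phi> ` B d = ?pt ` T d" for d
  proof -
    have "\<phi> ` B d = ?pt ` \<psi> ` B d"
      unfolding image_image by (intro image_cong refl \<phi>_basis) blast
    then show ?thesis using \<psi>[of d] by (simp add: bij_betw_def)
  qed
  then have \<phi>_imageU: "\<phi> ` (\<Union>d. B d) = ?pt ` (\<Union>d. T d)"
    by (simp add: image_UN)
  have "inj_on (?pt \<circ> \<psi>) (\<Union>d. B d)"
    using \<psi>U tb(1) by (intro comp_inj_on) (simp_all add: bij_betw_def)
  then have "inj_on \<phi> (\<Union>d. B d)"
    by (subst inj_on_cong[where g = "?pt \<circ> \<psi>"]) (simp_all add: \<phi>_basis)
  \<comment> \<open>The images of the basis are independent by \<open>pure_tensor_basis\<close>, so
    injectivity passes from the basis to its span.\<close>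
  then have inj: "inj_on \<phi> (fs.span (\<Union>d. B d))"
    by (intro vp.linear_inj_on_span_independent_image[OF lin]) (simp_all only: \<phi>_imageU tb(2) not_False_eq_True)
  have "graded_subspace (fs.span (\<Union>i. Y i)) (fs.span (\<Union>d. B d))"
    unfolding graded_subspace_def
  proof (intro conjI ballI allI)
    show "fs.span (\<Union>i. Y i) \<subseteq> fs.span (\<Union>d. B d)" by (rule fs.span_mono[OF UYB])
    fix f d assume "f \<in> fs.span (\<Union>i. Y i)"
    with homY have "homogeneous_component d f \<in> fs.span (Y d)"
      by (rule homogeneous_component_in_span)
    moreover have "fs.span (Y d) \<subseteq> fs.span (\<Union>i. Y i)" by (rule fs.span_mono) blast
    ultimately show "homogeneous_component d f \<in> fs.span (\<Union>i. Y i)" by blast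
  qed (rule fs.subspace_span)
  moreover have "linear_iso_betw \<phi> (fs.span (\<Union>d. B d))
      (tensor_space (fs.span (\<Union>i. Y i)) (fs.span (\<Union>d. L d)))"
    unfolding linear_iso_betw_def bij_betw_def tensor_space_span UT[symmetric] \<phi>_imageU[symmetric]
    using inj by (simp add: \<phi>.add \<phi>.scale vp.linear_span_image[OF lin])
  moreover have "\<phi> ` degree_part d (fs.span (\<Union>d. B d)) =
      tensor_degree_part d (fs.span (\<Union>i. Y i)) (fs.span (\<Union>d. L d))" for d
  proof -
    have "degree_part d (fs.span (\<Union>d. B d)) = fs.span (B d)"
      using homB by (rule degree_part_span)
    moreover have "tensor_degree_part d (fs.span (\<Union>i. Y i)) (fs.span (\<Union>d. L d)) = fs.span (?pt ` T d)"
      unfolding T_def using homY homL by (rule tensor_degree_part_span)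
    ultimately show ?thesis
      by (simp only: \<phi>_image[symmetric] vp.linear_span_image[OF lin])
  qed
  ultimately show ?thesis by blast
qed


section \<open>Nonnegativity of the quotient of Hilbert series\<close>

lemma fps_mult_mono_int:
  fixes a b c e :: "int fps"
  assumes "\<And>d. a $ d \<le> b $ d" "\<And>d. c $ d \<le> e $ d" "\<And>d. 0 \<le> a $ d" "\<And>d. 0 \<le> c $ d"
  shows "(a * c) $ d \<le> (b * e) $ d"
  unfolding fps_mult_nth
  by (intro sum_mono mult_mono) (use assms order_trans in blast)+

text \<open>The series 1 / (1 - k t); it is 1 for k = 0 because \<open>0 ^ 0 = 1\<close>.\<close>

definition geom_fps :: "nat \<Rightarrow> int fps" where
  "geom_fps k = Abs_fps (\<lambda>i. int k ^ i)"

lemma geom_fps_mult: "geom_fps k * (1 - of_nat k * fps_X) = 1"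
proof (rule fps_ext)
  fix i
  have "geom_fps k * (1 - of_nat k * fps_X) = geom_fps k - of_nat k * (geom_fps k * fps_X)"
    by (simp add: algebra_simps)
  then show "(geom_fps k * (1 - of_nat k * fps_X)) $ i = (1 :: int fps) $ i"
    by (cases i) (simp_all add: geom_fps_def fps_of_nat[symmetric])
qed

text \<open>The factor (1 - t^k) / (1 - k t) of \<open>Q\<^sub>n\<close>.\<close>

definition ratio_fps :: "nat \<Rightarrow> int fps" where
  "ratio_fps k = geom_fps k * (1 - fps_X ^ k)"

lemma ratio_fps_nth:
  "ratio_fps k $ i = (if i < k then int k ^ i else int k ^ i - int k ^ (i - k))"
proof -
  have "ratio_fps k = geom_fps k - geom_fps k * fps_X ^ k"
    by (simp add: ratio_fps_def algebra_simps)
  then show ?thesis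
    by (simp add: fps_X_power_mult_right_nth geom_fps_def)
qed

lemma ratio_fps_nonneg:
  assumes "k > 0"
  shows "0 \<le> ratio_fps k $ i"
  using assms by (auto simp: ratio_fps_nth intro!: power_increasing)

text \<open>Only degrees 0 and \<open>n\<close> matter, and both lie below \<open>Suc n\<close>,
  where nothing is subtracted and the coefficient is a power of \<open>Suc n\<close>. For
  \<open>n = 0\<close> the two degrees would coincide and the bound would fail.\<close>

lemma ratio_fps_ge:
  assumes "n > 0"
  shows "(1 + fps_X ^ n) $ i \<le> ratio_fps (Suc n) $ i"
proof (cases "i = 0 \<or> i = n")
  case True
  then show ?thesis using assms by (auto simp: ratio_fps_nth)
next
  case False
  then show ?thesis using ratio_fps_nonneg[of "Suc n" i] by simp
qed

text \<open>The reciprocal of the generating function of partitions into at most \<open>n\<close>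
  parts; see \<open>multisets_fps_mult_euler_fps\<close>.\<close>

definition euler_fps :: "nat \<Rightarrow> int fps" where
  "euler_fps n = (\<Prod>i=1..n. 1 - fps_X ^ i)"

text \<open>The generating function, in the number of points, of the Stirling numbers of the second
  kind for \<open>n\<close> blocks.\<close>

definition stirling_fps :: "nat \<Rightarrow> int fps" where
  "stirling_fps n = fps_X ^ n * (\<Prod>i=1..n. geom_fps i)"

definition quotient_fps :: "nat \<Rightarrow> int fps" where
  "quotient_fps n = euler_fps n * (\<Sum>k\<le>n. stirling_fps k)"

definition ratio_prod_fps :: "nat \<Rightarrow> int fps" where
  "ratio_prod_fps n = (\<Prod>i=1..n. ratio_fps i)"

lemma euler_mult_stirling_fps: "euler_fps n * stirling_fps n = fps_X ^ n * ratio_prod_fps n"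
  by (simp add: euler_fps_def stirling_fps_def ratio_prod_fps_def ratio_fps_def prod.distrib mult_ac)

text \<open>The new summand contributes \<open>fps_X ^ Suc n * ratio_prod_fps (Suc n)\<close>; the
  old ones only gain the factor \<open>1 - fps_X ^ Suc n\<close>.\<close>

lemma quotient_fps_Suc:
  "quotient_fps (Suc n) =
     quotient_fps n + fps_X ^ Suc n * (ratio_prod_fps (Suc n) - quotient_fps n)"
proof -
  have "quotient_fps (Suc n) =
      euler_fps (Suc n) * (\<Sum>k\<le>n. stirling_fps k) + fps_X ^ Suc n * ratio_prod_fps (Suc n)"
    by (simp only: quotient_fps_def sum.atMost_Suc distrib_left euler_mult_stirling_fps)
  also have "euler_fps (Suc n) * (\<Sum>k\<le>n. stirling_fps k) = quotient_fps n * (1 - fps_X ^ Suc n)"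
    by (simp add: quotient_fps_def euler_fps_def mult_ac)
  finally show ?thesis
    by (simp add: algebra_simps)
qed

text \<open>
  The upper bound is what keeps the induction going: it makes the correction term of
  \<open>quotient_fps_Suc\<close> nonnegative.
\<close>
lemma quotient_fps_bounds:
  "0 \<le> quotient_fps n $ d \<and> quotient_fps n $ d \<le> ratio_prod_fps (Suc n) $ d"
proof (induction n arbitrary: d)
  case 0
  have "quotient_fps 0 = 1"
    by (simp add: quotient_fps_def euler_fps_def stirling_fps_def)
  moreover have "ratio_prod_fps (Suc 0) = 1"
    using geom_fps_mult[of 1] by (simp add: ratio_prod_fps_def ratio_fps_def)
  ultimately show ?case by simp
next
  case (Suc n)
  let ?Q = "ratio_prod_fps (Suc n)" and ?G = "quotient_fps n"
  have nth: "quotient_fps (Suc n) $ i =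
      ?G $ i + (if i < Suc n then 0 else ?Q $ (i - Suc n) - ?G $ (i - Suc n))" for i
    unfolding quotient_fps_Suc fps_add_nth fps_X_power_mult_nth fps_sub_nth by simp
  have "0 \<le> quotient_fps (Suc n) $ d"
    using Suc.IH unfolding nth by (smt (verit))
  \<comment> \<open>Both bounds of the induction hypothesis enter: \<open>?G\<close> is at most
    \<open>?Q\<close> in degree \<open>d\<close>, and the subtracted coefficient of
    \<open>?G\<close> is nonnegative.\<close>
  moreover have "quotient_fps (Suc n) $ d \<le> (?Q * (1 + fps_X ^ Suc n)) $ d"
  proof -
    have "(?Q * (1 + fps_X ^ Suc n)) $ d = ?Q $ d + (if d < Suc n then 0 else ?Q $ (d - Suc n))"
      unfolding distrib_left fps_add_nth fps_X_power_mult_right_nth by simp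
    then show ?thesis
      using Suc.IH[of d] Suc.IH[of "d - Suc n"] unfolding nth by simp
  qed
  moreover have "(?Q * (1 + fps_X ^ Suc n)) $ d \<le> (?Q * ratio_fps (Suc (Suc n))) $ d"
  proof (rule fps_mult_mono_int)
    show "0 \<le> ?Q $ i" for i
      using Suc.IH order_trans by blast
    show "(0 :: int) \<le> (1 + fps_X ^ Suc n) $ i" for i
      by simp
  qed (rule order_refl ratio_fps_ge zero_less_Suc)+
  moreover have "?Q * ratio_fps (Suc (Suc n)) = ratio_prod_fps (Suc (Suc n))"
    by (simp add: ratio_prod_fps_def)
  ultimately show ?case by simp
qed

text \<open>The correction that leads from \<open>m\<close> to \<open>Suc m\<close> is divisible by
  \<open>fps_X ^ Suc m\<close>, hence invisible in degrees up to \<open>m\<close>.\<close>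

lemma quotient_fps_stable:
  assumes "i \<le> n"
  shows "quotient_fps n $ i = quotient_fps i $ i"
  using assms
proof (induction rule: dec_induct)
  case (step m)
  then have "quotient_fps (Suc m) $ i = quotient_fps m $ i"
    unfolding quotient_fps_Suc fps_add_nth fps_X_power_mult_nth by simp
  with step show ?case by simp
qed simp


section \<open>Restricted growth words\<close>

text \<open>Restricted growth is read from the right end of the word.\<close>
primrec restricted_growth :: "nat list \<Rightarrow> bool" where
  "restricted_growth [] \<longleftrightarrow> True"
| "restricted_growth (x # w) \<longleftrightarrow> restricted_growth w \<and> x \<le> card (set w)"

lemma restricted_growth_set:
  "restricted_growth w \<Longrightarrow> set w = {..<card (set w)}"
proof (induction w)
  case (Cons x w)
  then have IH: "set w = {..<card (set w)}" by simp
  show ?case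
  proof (cases "x < card (set w)")
    case True
    with IH have "x \<in> set w" by auto
    with IH show ?thesis by (simp add: insert_absorb)
  next
    case False
    with Cons have x: "x = card (set w)" by simp
    with IH have "x \<notin> set w" by (metis lessThan_iff less_irrefl)
    then have "card (set (x # w)) = Suc x" by (simp add: x)
    moreover have "set (x # w) = insert x {..<x}" using IH x by simp
    ultimately show ?thesis by (simp add: lessThan_Suc)
  qed
qed simp

lemma nth_eq_iff_word_type:
  assumes "i < length w" "j < length w"
  shows "w ! i = w ! j \<longleftrightarrow> (\<exists>P\<in>word_type w. Suc i \<in> P \<and> Suc j \<in> P)"
proof
  assume "w ! i = w ! j"
  with assms have "Suc i \<in> {k \<in> {1..length w}. w ! (k - 1) = w ! i}"
      "Suc j \<in> {k \<in> {1..length w}. w ! (k - 1) = w ! i}" by auto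
  moreover have "{k \<in> {1..length w}. w ! (k - 1) = w ! i} \<in> word_type w"
    using assms unfolding word_type_def by auto
  ultimately show "\<exists>P\<in>word_type w. Suc i \<in> P \<and> Suc j \<in> P" by (meson bexI)
qed (auto simp: word_type_def)

lemma length_eq_if_word_type_eq:
  assumes "word_type u = word_type v"
  shows "length u = length v"
proof -
  have "{1..length u} = {1..length v}"
    using word_type_partition_on[of u] word_type_partition_on[of v] assms
    by (simp add: partition_on_def)
  then show ?thesis by (metis card_atLeastAtMost diff_Suc_1)
qed

text \<open>Given equal tails, the head is either a repetition, which the equality pattern
  determines, or a new letter, which restricted growth determines.\<close>

lemma restricted_growth_unique:
  assumes "restricted_growth u" "restricted_growth v" "length u = length v"
    and "\<And>i j. i < length u \<Longrightarrow> j < length u \<Longrightarrow> u ! i = u ! j \<longleftrightarrow> v ! i = v ! j"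
  shows "u = v"
  using assms
proof (induction u arbitrary: v)
  case (Cons x u)
  then obtain y v' where v: "v = y # v'" by (cases v) auto
  have pattern: "i < Suc (length u) \<Longrightarrow> j < Suc (length u) \<Longrightarrow>
      (x # u) ! i = (x # u) ! j \<longleftrightarrow> (y # v') ! i = (y # v') ! j" for i j
    using Cons.prems(4) v by simp
  have uv: "u = v'"
    using Cons.prems v pattern[of "Suc i" "Suc j" for i j] by (intro Cons.IH) auto
  have eq: "x = u ! i \<longleftrightarrow> y = u ! i" if "i < length u" for i
    using pattern[of 0 "Suc i"] that uv by simp
  have "x = y"
  proof (cases "x \<in> set u \<or> y \<in> set u")
    case True
    then show ?thesis using eq by (auto simp: in_set_conv_nth)
  next
    case False
    \<comment> \<open>The letters of \<open>u\<close> fill \<open>{..<card (set u)}\<close>, so the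
      growth bound leaves a new letter a single value.\<close>
    have "z = card (set u)" if "z \<le> card (set u)" "z \<notin> set u" for z
      using that restricted_growth_set[of u] Cons.prems(1) by fastforce
    with False Cons.prems(1,2) uv v show ?thesis by (metis restricted_growth.simps(2))
  qed
  with uv v show ?case by simp
qed simp

lemma word_type_inj_on_restricted_growth: "inj_on word_type {w. restricted_growth w}"
proof (rule inj_onI)
  fix u v assume "u \<in> {w. restricted_growth w}" "v \<in> {w. restricted_growth w}"
    and t: "word_type u = word_type v"
  moreover have len: "length u = length v" by (rule length_eq_if_word_type_eq[OF t])
  ultimately show "u = v"
    by (intro restricted_growth_unique) (simp_all add: nth_eq_iff_word_type)
qed

lemma word_type_map:
  assumes "inj_on f (set w)"
  shows "word_type (map f w) = word_type w"
proof -
  have eq: "{i \<in> {1..length w}. map f w ! (i - 1) = f x} = {i \<in> {1..length w}. w ! (i - 1) = x}"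
    if "x \<in> set w" for x
    using that inj_on_eq_iff[OF assms] by auto
  have map: "word_type (map f w) =
      (\<lambda>x. {i \<in> {1..length w}. map f w ! (i - 1) = f x}) ` set w"
    by (auto simp: word_type_def)
  have w: "word_type w = (\<lambda>x. {i \<in> {1..length w}. w ! (i - 1) = x}) ` set w"
    by (auto simp: word_type_def)
  show ?thesis unfolding map w by (rule image_cong[OF refl eq])
qed

text \<open>The letters are renumbered in the order of their first appearance from the
  right.\<close>

lemma ex_restricted_growth_map: "\<exists>f. inj_on f (set w) \<and> restricted_growth (map f w)"
proof (induction w)
  case (Cons x w)
  then obtain f where f: "inj_on f (set w)" "restricted_growth (map f w)" by blast
  have set_f: "f ` set w = {..<card (set w)}"
    using restricted_growth_set[OF f(2)] card_image[OF f(1)] by simp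
  show ?case
  proof (cases "x \<in> set w")
    case True
    then have "f x < card (set w)" using set_f by blast
    with True f show ?thesis
      by (intro exI[of _ f]) (simp add: insert_absorb card_image)
  next
    case False
    let ?f = "f(x := card (set w))"
    have map: "map ?f w = map f w" using False by simp
    have "?f ` set w = f ` set w" using False by (intro image_cong) auto
    moreover have "inj_on ?f (set w)" using f(1) by (rule inj_on_cong[THEN iffD1, rotated]) (use False in auto)
    ultimately have "inj_on ?f (set (x # w))"
      using set_f by (simp only: list.set inj_on_insert) auto
    moreover have "restricted_growth (map ?f (x # w))"
      using f by (simp only: list.map(2) map) (simp add: card_image)
    ultimately show ?thesis by blast
  qed
qed simp

lemma card_set_le_if_monomial:
  assumes "w \<in> monomials n"
  shows "enat (card (set w)) \<le> n"
proof (cases n)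
  case (enat m)
  then have "set w \<subseteq> {..<m}" using assms by (auto simp: monomials_def)
  then show ?thesis using card_mono[of "{..<m}" "set w"] enat by simp
qed simp

lemma restricted_growth_monomial_iff:
  assumes "restricted_growth w"
  shows "w \<in> monomials n \<longleftrightarrow> enat (card (set w)) \<le> n"
proof
  assume n: "enat (card (set w)) \<le> n"
  have "enat x < n" if "x \<in> set w" for x
  proof -
    have "x < card (set w)" using that restricted_growth_set[OF assms] by auto
    then show ?thesis using n by (meson enat_ord_simps(2) less_le_trans)
  qed
  then show "w \<in> monomials n" by (simp add: monomials_def)
qed (rule card_set_le_if_monomial)

text \<open>Renumbering keeps the type and the number of letters, so restricted growth words
  represent every type that a monomial has.\<close>

lemma ex_restricted_growth_monomial:
  assumes "w \<in> monomials n"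
  shows "\<exists>v. restricted_growth v \<and> v \<in> monomials n \<and> word_type v = word_type w"
proof -
  obtain f where f: "inj_on f (set w)" "restricted_growth (map f w)"
    using ex_restricted_growth_map by blast
  then have "map f w \<in> monomials n"
    using card_set_le_if_monomial[OF assms] by (simp add: restricted_growth_monomial_iff card_image)
  with f word_type_map show ?thesis by blast
qed

definition rg_words :: "nat \<Rightarrow> nat \<Rightarrow> nat list set" where
  "rg_words k d = {w. length w = d \<and> restricted_growth w \<and> card (set w) = k}"

lemma finite_rg_words: "finite (rg_words k d)"
proof (rule finite_subset)
  show "rg_words k d \<subseteq> {w. set w \<subseteq> {..<k} \<and> length w = d}"
  proof
    fix w assume w: "w \<in> rg_words k d"
    then have "set w = {..<card (set w)}"
      by (intro restricted_growth_set) (simp add: rg_words_def)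
    with w show "w \<in> {w. set w \<subseteq> {..<k} \<and> length w = d}"
      unfolding rg_words_def by blast
  qed
  show "finite {w. set w \<subseteq> {..<k} \<and> length w = d}"
    by (rule finite_lists_length_eq) simp
qed

lemma rg_words_0: "rg_words k 0 = (if k = 0 then {[]} else {})"
  by (auto simp: rg_words_def)

lemma rg_words_0_Suc: "rg_words 0 (Suc d) = {}"
  by (auto simp: rg_words_def)


text \<open>This is the Stirling recurrence. After deletion of the head, either all
  \<open>Suc k\<close> letters remain and the head was any of them, or \<open>k\<close> remain and
  the head was the new letter \<open>k\<close>.\<close>

lemma card_rg_words_Suc:
  "card (rg_words (Suc k) (Suc d)) = Suc k * card (rg_words (Suc k) d) + card (rg_words k d)"
proof -
  let ?A = "(\<lambda>(x, w). x # w) ` ({..k} \<times> rg_words (Suc k) d)" and ?B = "(#) k ` rg_words k d"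
  have ins: "card (insert x (set w)) = (if x < card (set w) then card (set w) else Suc (card (set w)))"
    if "restricted_growth w" "x \<le> card (set w)" for x w
  proof -
    have "x \<in> set w \<longleftrightarrow> x < card (set w)"
      using restricted_growth_set[OF that(1)] by (metis lessThan_iff)
    then show ?thesis by (auto simp: card_insert_if)
  qed
  have "rg_words (Suc k) (Suc d) = ?A \<union> ?B"
  proof (intro set_eqI iffI)
    fix w assume "w \<in> rg_words (Suc k) (Suc d)"
    then obtain x v where w: "w = x # v" "length v = d" "restricted_growth v" "x \<le> card (set v)"
        "card (insert x (set v)) = Suc k"
      by (cases w) (auto simp: rg_words_def)
    then show "w \<in> ?A \<union> ?B"
      using ins[OF w(3,4)] by (auto simp: rg_words_def image_iff split: if_splits)
  next
    fix w assume "w \<in> ?A \<union> ?B"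
    then show "w \<in> rg_words (Suc k) (Suc d)"
      using ins by (auto simp: rg_words_def)
  qed
  moreover have "?A \<inter> ?B = {}" by (auto simp: rg_words_def)
  moreover have "card ?A = Suc k * card (rg_words (Suc k) d)"
    by (subst card_image) (auto simp: inj_on_def card_cartesian_product)
  moreover have "card ?B = card (rg_words k d)"
    by (rule card_image) simp
  ultimately show ?thesis
    by (simp add: card_Un_disjoint finite_rg_words)
qed


section \<open>Integer partitions\<close>

text \<open>Zero entries are allowed: they pad a partition with at most \<open>m\<close> parts to
  exactly \<open>m\<close> entries.\<close>

definition multisets :: "nat \<Rightarrow> nat \<Rightarrow> nat multiset set" where
  "multisets m d = {\<mu>. size \<mu> = m \<and> sum_mset \<mu> = d}"

lemma finite_multisets: "finite (multisets m d)"
proof (rule finite_subset)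
  show "multisets m d \<subseteq> mset ` {xs. set xs \<subseteq> {..d} \<and> length xs = m}"
  proof
    fix \<mu> assume \<mu>: "\<mu> \<in> multisets m d"
    obtain xs where xs: "\<mu> = mset xs" using ex_mset by metis
    have "x \<le> sum_mset \<mu>" if "x \<in># \<mu>" for x
      using sum_mset.remove[OF that] by simp
    with \<mu> xs show "\<mu> \<in> mset ` {xs. set xs \<subseteq> {..d} \<and> length xs = m}"
      by (auto simp: multisets_def)
  qed
  show "finite (mset ` {xs. set xs \<subseteq> {..d} \<and> length xs = m})"
    by (intro finite_imageI finite_lists_length_eq) simp
qed

lemma multisets_0: "multisets 0 d = (if d = 0 then {{#}} else {})"
  by (auto simp: multisets_def)

lemma sum_mset_image_Suc: "sum_mset (image_mset Suc \<mu>) = sum_mset \<mu> + size \<mu>"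
  by (induction \<mu>) auto

text \<open>Either a zero entry can be removed, or all \<open>Suc m\<close> entries are positive and
  can be lowered by one.\<close>

lemma card_multisets_Suc:
  "card (multisets (Suc m) d) =
     card (multisets m d) + (if d < Suc m then 0 else card (multisets (Suc m) (d - Suc m)))"
proof -
  let ?A = "add_mset 0 ` multisets m d"
  \<comment> \<open>Without the case distinction, truncated subtraction would yield degree 0 and
    admit the all-zero multiset.\<close>
  let ?B = "if d < Suc m then {} else image_mset Suc ` multisets (Suc m) (d - Suc m)"
  have "multisets (Suc m) d = ?A \<union> ?B"
  proof (intro set_eqI iffI)
    fix \<mu> assume \<mu>: "\<mu> \<in> multisets (Suc m) d"
    show "\<mu> \<in> ?A \<union> ?B"
    proof (cases "0 \<in># \<mu>")
      case True
      then obtain \<nu> where "\<mu> = add_mset 0 \<nu>" by (metis mset_add)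
      with \<mu> show ?thesis by (auto simp: multisets_def)
    next
      case False
      have "image_mset Suc (image_mset (\<lambda>x. x - 1) \<mu>) = image_mset (\<lambda>x. x) \<mu>"
        unfolding multiset.map_comp
      proof (rule image_mset_cong)
        fix x assume "x \<in># \<mu>"
        with False have "x \<noteq> 0" by metis
        then show "(Suc \<circ> (\<lambda>x. x - 1)) x = x" by simp
      qed
      then have eq: "\<mu> = image_mset Suc (image_mset (\<lambda>x. x - 1) \<mu>)" (is "_ = image_mset Suc ?\<nu>")
        by simp
      have "sum_mset \<mu> = sum_mset ?\<nu> + size ?\<nu>"
        by (subst eq) (rule sum_mset_image_Suc)
      with \<mu> have "d \<ge> Suc m" "?\<nu> \<in> multisets (Suc m) (d - Suc m)"
        by (auto simp: multisets_def)
      with eq show ?thesis by auto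
    qed
  next
    fix \<mu> assume "\<mu> \<in> ?A \<union> ?B"
    then show "\<mu> \<in> multisets (Suc m) d"
      by (auto simp: multisets_def sum_mset_image_Suc split: if_splits)
  qed
  moreover have "?A \<inter> ?B = {}"
  proof -
    have "0 \<in># \<mu>" if "\<mu> \<in> ?A" for \<mu> using that by auto
    moreover have "0 \<notin># \<mu>" if "\<mu> \<in> ?B" for \<mu> using that by (auto split: if_splits)
    ultimately show ?thesis by blast
  qed
  moreover have "card ?A = card (multisets m d)" by (simp add: card_image inj_on_def)
  moreover have "card ?B = (if d < Suc m then 0 else card (multisets (Suc m) (d - Suc m)))"
    by (simp add: card_image inj_on_subset[OF multiset.inj_map[OF inj_Suc]])
  ultimately show ?thesis
    by (simp add: card_Un_disjoint finite_multisets)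
qed

lemma card_partitions_eq_card_multisets:
  "card {\<mu>. 0 \<notin># \<mu> \<and> size \<mu> \<le> m \<and> sum_mset \<mu> = d} = card (multisets m d)"
proof -
  let ?P = "{\<mu>. 0 \<notin># \<mu> \<and> size \<mu> \<le> m \<and> sum_mset \<mu> = d}"
  let ?f = "\<lambda>\<mu>. \<mu> + replicate_mset (m - size \<mu>) (0::nat)" and ?g = "filter_mset (\<lambda>x. x \<noteq> (0::nat))"
  have split: "\<nu> = ?g \<nu> + replicate_mset (count \<nu> 0) 0" for \<nu>
    by (rule multiset_eqI) auto
  have sz: "size \<nu> = size (?g \<nu>) + count \<nu> 0" for \<nu>
    by (subst split) simp
  have sm: "sum_mset \<nu> = sum_mset (?g \<nu>)" for \<nu>
    by (subst split) simp
  have "bij_betw ?f ?P (multisets m d)"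
  proof (rule bij_betw_byWitness[where f' = ?g])
    show "\<forall>\<mu>\<in>?P. ?g (?f \<mu>) = \<mu>"
    proof
      fix \<mu> :: "nat multiset" assume "\<mu> \<in> ?P"
      then have "count \<mu> 0 = 0" by (simp add: not_in_iff)
      then show "?g (?f \<mu>) = \<mu>" by (intro multiset_eqI) auto
    qed
    show "\<forall>\<nu>\<in>multisets m d. ?f (?g \<nu>) = \<nu>"
    proof
      fix \<nu> assume "\<nu> \<in> multisets m d"
      then have "m - size (?g \<nu>) = count \<nu> 0" using sz[of \<nu>] unfolding multisets_def
        by (metis (lifting) add_diff_cancel_left' mem_Collect_eq)
      then show "?f (?g \<nu>) = \<nu>" using split[of \<nu>] by simp
    qed
    show "?f ` ?P \<subseteq> multisets m d"
      by (auto simp: multisets_def)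
    show "?g ` multisets m d \<subseteq> ?P"
    proof
      fix \<mu> assume "\<mu> \<in> ?g ` multisets m d"
      then obtain \<nu> where \<nu>: "\<nu> \<in> multisets m d" "\<mu> = ?g \<nu>" by blast
      have "size \<mu> \<le> size \<nu>" "sum_mset \<mu> = sum_mset \<nu>"
        unfolding \<nu>(2) using sz[of \<nu>] sm[of \<nu>] by linarith+
      with \<nu> show "\<mu> \<in> ?P" by (simp add: multisets_def)
    qed
  qed
  then show ?thesis by (rule bij_betw_same_card)
qed

lemma size_le_sum_mset:
  fixes \<mu> :: "nat multiset"
  assumes "0 \<notin># \<mu>"
  shows "size \<mu> \<le> sum_mset \<mu>"
  using assms by (induction \<mu>) auto


section \<open>The convolution identity\<close>

text \<open>The recurrence of \<open>card_rg_words_Suc\<close> says that passing from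
  \<open>k\<close> to \<open>Suc k\<close> multiplies the generating function by t / (1 - (k + 1)
  t).\<close>

lemma stirling_fps_nth: "stirling_fps k $ d = int (card (rg_words k d))"
proof -
  define s where "s k = Abs_fps (\<lambda>d. int (card (rg_words k d)))" for k
  have "s k = stirling_fps k"
  proof (induction k)
    case 0
    have "s 0 = 1"
    proof (rule fps_ext)
      show "s 0 $ d = 1 $ d" for d
        by (cases d) (simp_all add: s_def rg_words_0 rg_words_0_Suc)
    qed
    then show ?case by (simp add: stirling_fps_def)
  next
    case (Suc k)
    have rec: "s (Suc k) * (1 - of_nat (Suc k) * fps_X) = fps_X * s k"
    proof (rule fps_ext)
      fix d
      have "s (Suc k) * (1 - of_nat (Suc k) * fps_X) =
          s (Suc k) - of_nat (Suc k) * (s (Suc k) * fps_X)"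
        by (simp add: algebra_simps)
      then show "(s (Suc k) * (1 - of_nat (Suc k) * fps_X)) $ d = (fps_X * s k) $ d"
        by (cases d) (simp_all add: s_def card_rg_words_Suc rg_words_0 del: of_nat_Suc, simp add: algebra_simps)
    qed
    \<comment> \<open>Division by \<open>1 - of_nat (Suc k) * fps_X\<close> is carried out by
      inserting its product with its inverse \<open>geom_fps (Suc k)\<close>.\<close>
    have "s (Suc k) = s (Suc k) * (geom_fps (Suc k) * (1 - of_nat (Suc k) * fps_X))"
      by (simp only: geom_fps_mult mult_1_right)
    also have "\<dots> = fps_X * s k * geom_fps (Suc k)"
      by (simp only: rec[symmetric] mult_ac)
    also have "\<dots> = stirling_fps (Suc k)"
      by (simp add: Suc.IH stirling_fps_def mult_ac)
    finally show ?case .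
  qed
  then show ?thesis by (simp add: s_def fps_eq_iff)
qed

text \<open>By \<open>card_multisets_Suc\<close>, multiplication by \<open>1 - fps_X ^ Suc n\<close>
  turns the series for \<open>Suc n\<close> into the one for \<open>n\<close>.\<close>

lemma multisets_fps_mult_euler_fps:
  "Abs_fps (\<lambda>d. int (card (multisets n d))) * euler_fps n = 1"
proof (induction n)
  case 0
  show ?case
    by (rule fps_ext) (simp add: multisets_0 euler_fps_def)
next
  case (Suc n)
  let ?p = "\<lambda>n. Abs_fps (\<lambda>d. int (card (multisets n d)))"
  have "?p (Suc n) * (1 - fps_X ^ Suc n) = ?p n"
  proof (rule fps_ext)
    fix d
    have "?p (Suc n) * (1 - fps_X ^ Suc n) = ?p (Suc n) - ?p (Suc n) * fps_X ^ Suc n"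
      by (simp add: algebra_simps)
    then show "(?p (Suc n) * (1 - fps_X ^ Suc n)) $ d = ?p n $ d"
      by (simp only: fps_sub_nth fps_X_power_mult_right_nth) (simp add: card_multisets_Suc[of n d])
  qed
  moreover have "euler_fps (Suc n) = (1 - fps_X ^ Suc n) * euler_fps n"
    by (simp add: euler_fps_def mult.commute)
  ultimately show ?case
    using Suc.IH by (simp only: mult.assoc[symmetric])
qed

text \<open>Cancelling \<open>euler_fps m\<close> against its inverse recovers the sum of the
  Stirling series. This becomes the counting hypothesis of
  \<open>graded_tensor_decomposition\<close>.\<close>

lemma card_rg_words_convolution:
  "(\<Sum>k\<le>m. int (card (rg_words k d))) =
     (\<Sum>i\<le>d. quotient_fps m $ i * int (card (multisets m (d - i))))"
proof -
  let ?p = "Abs_fps (\<lambda>d. int (card (multisets m d)))"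
  have "quotient_fps m * ?p = (\<Sum>k\<le>m. stirling_fps k) * (?p * euler_fps m)"
    by (simp add: quotient_fps_def mult_ac)
  also have "\<dots> = (\<Sum>k\<le>m. stirling_fps k)"
    by (simp only: multisets_fps_mult_euler_fps mult_1_right)
  finally have "(\<Sum>k\<le>m. stirling_fps k) $ d = (quotient_fps m * ?p) $ d" by simp
  then show ?thesis
    by (simp add: fps_sum_nth stirling_fps_nth fps_mult_nth atLeast0AtMost)
qed


section \<open>Homogeneous bases\<close>

lemma sum_fun_apply: "(\<Sum>x\<in>X. h x) y = (\<Sum>x\<in>X. h x y)"
  for h :: "'x \<Rightarrow> 'y \<Rightarrow> 'k::comm_monoid_add"
  by (induction X rule: infinite_finite_induct) auto

text \<open>Evaluating a linear relation at a point of the support of \<open>b\<close> isolates the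
  coefficient of \<open>b\<close>.\<close>

lemma independent_if_disjoint_supports:
  fixes B :: "('w \<Rightarrow> 'k::field) set"
  assumes nz: "0 \<notin> B"
    and disj: "\<And>b b' w. b \<in> B \<Longrightarrow> b' \<in> B \<Longrightarrow> b w \<noteq> 0 \<Longrightarrow> b' w \<noteq> 0 \<Longrightarrow> b = b'"
  shows "fs.independent B"
  unfolding fs.independent_explicit_finite_subsets
proof (intro allI impI ballI)
  fix S u b assume S: "S \<subseteq> B" "finite S" and 0: "(\<Sum>v\<in>S. fscale (u v) v) = 0" and b: "b \<in> S"
  have "b \<noteq> 0" using nz S b by blast
  then obtain w where w: "b w \<noteq> 0" by (auto simp: fun_eq_iff)
  have "0 = (\<Sum>v\<in>S. fscale (u v) v) w" by (simp add: 0)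
  also have "\<dots> = (\<Sum>v\<in>S. u v * v w)" by (simp add: sum_fun_apply fscale_def)
  also have "\<dots> = (\<Sum>v\<in>{b}. u v * v w)"
  proof (rule sum.mono_neutral_right)
    show "\<forall>v\<in>S - {b}. u v * v w = 0"
    proof
      fix v assume "v \<in> S - {b}"
      then have "v w = 0" using disj[of v b w] S b w by blast
      then show "u v * v w = 0" by simp
    qed
  qed (use S b in auto)
  finally show "u b = 0" using w by simp
qed

lemma shape_word_type: "shape (word_type w) = image_mset (count (mset w)) (mset_set (set w))"
proof -
  let ?block = "\<lambda>x. {i \<in> {1..length w}. w ! (i - 1) = x}"
  have wt: "word_type w = ?block ` set w"
    by (auto simp: word_type_def)
  \<comment> \<open>Injectivity keeps one part per letter, so the multiset of block sizes has the
    right multiplicities.\<close>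
  have inj: "inj_on ?block (set w)"
  proof (rule inj_onI)
    fix x y assume "x \<in> set w" and eq: "?block x = ?block y"
    then obtain j where "j < length w" "w ! j = x" by (auto simp: in_set_conv_nth)
    then have "Suc j \<in> ?block x" by simp
    then have "Suc j \<in> ?block y" using eq by blast
    with \<open>w ! j = x\<close> show "x = y" by simp
  qed
  have "card (?block x) = count (mset w) x" for x
  proof -
    have "?block x = Suc ` {j. j < length w \<and> w ! j = x}"
      by (auto simp: image_iff Suc_le_eq gr0_conv_Suc)
    then have "card (?block x) = card {j. j < length w \<and> w ! j = x}"
      by (simp add: card_image)
    also have "\<dots> = count (mset w) x"
      by (simp add: count_mset count_list_eq_length_filter length_filter_conv_card eq_commute[of x])
    finally show ?thesis .
  qed
  then show ?thesis
    unfolding shape_def wt image_mset_mset_set[OF inj, symmetric] multiset.map_comp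
    by (simp add: comp_def)
qed

lemma size_shape_word_type: "size (shape (word_type w)) = card (set w)"
  by (simp add: shape_word_type)

lemma sum_mset_shape_word_type: "sum_mset (shape (word_type w)) = length w"
proof -
  have "sum_mset (shape (word_type w)) = (\<Sum>x\<in>set w. count (mset w) x)"
    by (simp add: shape_word_type sum_unfold_sum_mset)
  also have "\<dots> = length w"
    by (metis size_multiset_overloaded_eq set_mset_mset size_mset)
  finally show ?thesis .
qed

lemma ex_word_of_shape:
  assumes "0 \<notin># \<mu>"
  shows "\<exists>w. set w = {..<size \<mu>} \<and> shape (word_type w) = \<mu>"
  using assms
proof (induction \<mu>)
  case empty
  show ?case by (intro exI[of _ "[]"]) (simp add: shape_word_type)
next
  case (add x \<mu>)
  then obtain w where w: "set w = {..<size \<mu>}" "shape (word_type w) = \<mu>" by auto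
  \<comment> \<open>The fresh letter \<open>size \<mu>\<close> supplies the new block; it does occur
    because \<open>x\<close> is nonzero.\<close>
  let ?w = "replicate x (size \<mu>) @ w"
  have set: "set ?w = insert (size \<mu>) {..<size \<mu>}" using add.prems w by simp
  have "image_mset (count (mset ?w)) (mset_set {..<size \<mu>}) =
      image_mset (count (mset w)) (mset_set {..<size \<mu>})"
    by (rule image_mset_cong) simp
  moreover have "count (mset w) (size \<mu>) = 0"
    using w(1) by (simp add: count_eq_zero_iff)
  ultimately have "shape (word_type ?w) = add_mset x \<mu>"
    using w unfolding shape_word_type set by simp
  with set show ?case by (intro exI[of _ ?w]) (simp add: lessThan_Suc)
qed

lemma word_type_in_set_partitions_of_shape_iff:
  "word_type w \<in> set_partitions_of_shape \<mu> \<longleftrightarrow> shape (word_type w) = \<mu>"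
  using word_type_partition_on[of w] sum_mset_shape_word_type[of w]
  by (auto simp: set_partitions_of_shape_def)

text \<open>This keeps the coefficient in \<open>bold_m\<close> away from the default value of
  division by 0.\<close>

lemma dim_NCSym_shape_nonzero:
  assumes w: "w \<in> monomials n"
  shows "fs.dim (NCSym_shape n (shape (word_type w)) :: (nat list \<Rightarrow> 'k::field) set) \<noteq> 0"
proof
  let ?G = "m_fun n ` set_partitions_of_shape (shape (word_type w)) :: (nat list \<Rightarrow> 'k) set"
  assume dim0: "fs.dim (NCSym_shape n (shape (word_type w)) :: (nat list \<Rightarrow> 'k) set) = 0"
  obtain B where B: "B \<subseteq> ?G" "fs.independent B" "?G \<subseteq> fs.span B" "card B = fs.dim ?G"
    using fs.basis_exists by blast
  \<comment> \<open>An infinite set also has \<open>card\<close> 0, so finiteness is what makes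
    \<open>B\<close> empty.\<close>
  have "finite B"
    using B(1) finite_set_partitions_of_shape finite_subset by blast
  moreover have "card B = 0"
    using B(4) dim0 by (simp add: NCSym_shape_def fs.dim_span)
  ultimately have "?G \<subseteq> {0}" using B(3) by simp
  moreover have "m_fun n (word_type w) \<in> ?G"
    by (simp add: word_type_in_set_partitions_of_shape_iff)
  ultimately have "(m_fun n (word_type w) :: nat list \<Rightarrow> 'k) w = 0" by auto
  with w show False by (simp add: m_fun_def)
qed

text \<open>Only the summand for \<open>word_type w\<close> can be nonzero at \<open>w\<close>, and
  in characteristic 0 the scalar in front does not vanish.\<close>

lemma bold_m_nonzero_iff:
  "(bold_m n \<mu> :: nat list \<Rightarrow> 'k::field_char_0) w \<noteq> 0 \<longleftrightarrow>
     w \<in> monomials n \<and> shape (word_type w) = \<mu>"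
proof -
  let ?c = "1 / (of_nat (fs.dim (NCSym_shape n \<mu> :: (nat list \<Rightarrow> 'k) set)) * of_nat (mult_fact \<mu>)) :: 'k"
  have "(\<Sum>A\<in>set_partitions_of_shape \<mu>. m_fun n A) w =
      (\<Sum>A\<in>set_partitions_of_shape \<mu>. if A = word_type w then (if w \<in> monomials n then 1 else 0) else 0 :: 'k)"
    unfolding sum_fun_apply by (intro sum.cong) (auto simp: m_fun_def)
  also have "\<dots> = (if w \<in> monomials n \<and> shape (word_type w) = \<mu> then 1 else 0)"
    by (simp add: finite_set_partitions_of_shape word_type_in_set_partitions_of_shape_iff)
  finally have "bold_m n \<mu> w = ?c * (if w \<in> monomials n \<and> shape (word_type w) = \<mu> then 1 else 0)"
    by (simp add: bold_m_def fscale_def)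
  moreover have "?c \<noteq> 0" if "w \<in> monomials n" "shape (word_type w) = \<mu>"
    using dim_NCSym_shape_nonzero[of w n, where 'k = 'k] that by (auto simp: mult_fact_def)
  ultimately show ?thesis by auto
qed

section \<open>The basis of \<open>Lambda\<close>, indexed by partitions with at most
  \<open>n\<close> parts\<close>

definition part_shapes :: "enat \<Rightarrow> nat \<Rightarrow> nat multiset set" where
  "part_shapes n d = {\<mu>. 0 \<notin># \<mu> \<and> enat (size \<mu>) \<le> n \<and> sum_mset \<mu> = d}"

lemma ex_bold_m_nonzero:
  assumes "\<mu> \<in> part_shapes n d"
  shows "\<exists>w. (bold_m n \<mu> :: nat list \<Rightarrow> 'k::field_char_0) w \<noteq> 0"
proof -
  obtain w where w: "set w = {..<size \<mu>}" "shape (word_type w) = \<mu>"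
    using ex_word_of_shape[of \<mu>] assms by (auto simp: part_shapes_def)
  have "w \<in> monomials n"
    proof -
    have "enat x < n" if "x < size \<mu>" for x
    proof -
      have "enat x < enat (size \<mu>)" using that by simp
      also have "\<dots> \<le> n" using assms by (simp add: part_shapes_def)
      finally show ?thesis .
    qed
    then show ?thesis by (simp add: monomials_def w(1))
  qed
  with w show ?thesis unfolding bold_m_nonzero_iff by blast
qed

lemma bold_m_eq_if_common_support:
  assumes "(bold_m n \<mu> :: nat list \<Rightarrow> 'k::field_char_0) w \<noteq> 0"
    and "(bold_m n \<nu> :: nat list \<Rightarrow> 'k) w \<noteq> 0"
  shows "\<mu> = \<nu>"
  using assms by (simp add: bold_m_nonzero_iff)

lemma inj_on_bold_m: "inj_on (bold_m n :: _ \<Rightarrow> nat list \<Rightarrow> 'k::field_char_0) (part_shapes n d)"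
proof (rule inj_onI)
  fix \<mu> \<nu> assume "\<mu> \<in> part_shapes n d" and eq: "(bold_m n \<mu> :: nat list \<Rightarrow> 'k) = bold_m n \<nu>"
  then obtain w where "(bold_m n \<mu> :: nat list \<Rightarrow> 'k) w \<noteq> 0" using ex_bold_m_nonzero by blast
  with eq show "\<mu> = \<nu>" by (intro bold_m_eq_if_common_support[of n \<mu> w, where 'k = 'k]) simp_all
qed

lemma independent_bold_m:
  "fs.independent (\<Union>d. bold_m n ` part_shapes n d :: (nat list \<Rightarrow> 'k::field_char_0) set)"
proof (rule independent_if_disjoint_supports)
  show "0 \<notin> (\<Union>d. bold_m n ` part_shapes n d :: (nat list \<Rightarrow> 'k) set)"
  proof
    assume "0 \<in> (\<Union>d. bold_m n ` part_shapes n d :: (nat list \<Rightarrow> 'k) set)"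
    then obtain d \<mu> where "\<mu> \<in> part_shapes n d" "(bold_m n \<mu> :: nat list \<Rightarrow> 'k) = 0" by auto
    with ex_bold_m_nonzero[of \<mu> n d, where 'k = 'k] show False by simp
  qed
qed (auto dest: bold_m_eq_if_common_support)

text \<open>A partition with more than \<open>n\<close> parts contributes 0, since a monomial has at
  most \<open>n\<close> distinct letters and hence at most \<open>n\<close> blocks.\<close>

lemma Lambda_eq_span:
  "Lambda n = fs.span (\<Union>d. bold_m n ` part_shapes n d :: (nat list \<Rightarrow> 'k::field_char_0) set)"
proof
  let ?L = "\<Union>d. bold_m n ` part_shapes n d :: (nat list \<Rightarrow> 'k) set"
  show "Lambda n \<subseteq> fs.span ?L"
    unfolding Lambda_def
  proof (rule fs.span_minimal)
    show "{bold_m n \<mu> | \<mu>. 0 \<notin># \<mu>} \<subseteq> fs.span ?L"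
    proof clarify
      fix \<mu> :: "nat multiset" assume \<mu>: "0 \<notin># \<mu>"
      show "bold_m n \<mu> \<in> fs.span ?L"
      proof (cases "enat (size \<mu>) \<le> n")
        case True
        with \<mu> show ?thesis by (intro fs.span_base) (auto simp: part_shapes_def)
      next
        case False
        have "(bold_m n \<mu> :: nat list \<Rightarrow> 'k) w = 0" for w
        proof (rule ccontr)
          assume "(bold_m n \<mu> :: nat list \<Rightarrow> 'k) w \<noteq> 0"
          then have "w \<in> monomials n" "shape (word_type w) = \<mu>" by (simp_all add: bold_m_nonzero_iff)
          with False show False
            using card_set_le_if_monomial[of w n] size_shape_word_type[of w] by simp
        qed
        then have "(bold_m n \<mu> :: nat list \<Rightarrow> 'k) = 0" by (simp add: fun_eq_iff)
        then show ?thesis by (simp only: fs.span_zero)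
      qed
    qed
  qed (rule fs.subspace_span)
  show "fs.span ?L \<subseteq> Lambda n"
    unfolding Lambda_def by (rule fs.span_mono) (auto simp: part_shapes_def)
qed

section \<open>The basis of \<open>NCSym\<close>, indexed by restricted growth words\<close>

definition rg_monomials :: "enat \<Rightarrow> nat \<Rightarrow> nat list set" where
  "rg_monomials n d = {w. length w = d \<and> restricted_growth w \<and> w \<in> monomials n}"

definition NCSym_basis :: "enat \<Rightarrow> nat \<Rightarrow> (nat list \<Rightarrow> 'k::field) set" where
  "NCSym_basis n d = (\<lambda>w. m_fun n (word_type w)) ` rg_monomials n d"

lemma inj_on_m_fun_word_type:
  "inj_on (\<lambda>w. m_fun n (word_type w) :: nat list \<Rightarrow> 'k::field) (rg_monomials n d)"
proof (rule inj_onI)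
  fix u v assume uv: "u \<in> rg_monomials n d" "v \<in> rg_monomials n d"
    and eq: "(m_fun n (word_type u) :: nat list \<Rightarrow> 'k) = m_fun n (word_type v)"
  have "(m_fun n (word_type u) :: nat list \<Rightarrow> 'k) u = 1"
    using uv by (simp add: m_fun_def rg_monomials_def)
  then have "(m_fun n (word_type v) :: nat list \<Rightarrow> 'k) u = 1" using eq by simp
  then have "word_type u = word_type v" by (simp add: m_fun_def split: if_splits)
  with uv show "u = v"
    by (auto simp: rg_monomials_def dest: inj_onD[OF word_type_inj_on_restricted_growth])
qed

lemma independent_NCSym_basis:
  "fs.independent (\<Union>d. NCSym_basis n d :: (nat list \<Rightarrow> 'k::field) set)"
proof (rule independent_if_disjoint_supports)
  show "0 \<notin> (\<Union>d. NCSym_basis n d :: (nat list \<Rightarrow> 'k) set)"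
  proof
    assume "0 \<in> (\<Union>d. NCSym_basis n d :: (nat list \<Rightarrow> 'k) set)"
    then obtain w where "w \<in> monomials n" "(m_fun n (word_type w) :: nat list \<Rightarrow> 'k) = 0"
      by (auto simp: NCSym_basis_def rg_monomials_def)
    then have "w \<in> monomials n" "(m_fun n (word_type w) :: nat list \<Rightarrow> 'k) w = 0" by simp_all
    then show False by (simp add: m_fun_def)
  qed
qed (auto simp: NCSym_basis_def m_fun_def split: if_splits)

text \<open>A set partition that is the type of no monomial gives the zero function; every other one
  is the type of a restricted growth word.\<close>

lemma NCSym_eq_span: "NCSym n = fs.span (\<Union>d. NCSym_basis n d :: (nat list \<Rightarrow> 'k::field) set)"
proof
  let ?B = "\<Union>d. NCSym_basis n d :: (nat list \<Rightarrow> 'k) set"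
  show "NCSym n \<subseteq> fs.span ?B"
    unfolding NCSym_def
  proof (rule fs.span_minimal)
    show "{m_fun n A |A d. partition_on {1..d} A} \<subseteq> fs.span ?B"
    proof clarify
      fix A :: "nat set set"
      show "m_fun n A \<in> fs.span ?B"
      proof (cases "\<exists>w. w \<in> monomials n \<and> word_type w = A")
        case True
        then obtain v where "restricted_growth v" "v \<in> monomials n" "word_type v = A"
          using ex_restricted_growth_monomial by blast
        then have "m_fun n A \<in> ?B" by (auto simp: NCSym_basis_def rg_monomials_def)
        then show ?thesis by (rule fs.span_base)
      next
        case False
        then have "m_fun n A = (0 :: nat list \<Rightarrow> 'k)" by (auto simp: m_fun_def fun_eq_iff)
        then show ?thesis by (simp only: fs.span_zero)
      qed
    qed
  qed (rule fs.subspace_span)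
  show "fs.span ?B \<subseteq> NCSym n"
    unfolding NCSym_def using word_type_partition_on
    by (intro fs.span_mono) (auto simp: NCSym_basis_def)
qed

section \<open>Dimensions of the graded pieces and the conclusion\<close>

text \<open>
  The assumption below lets a natural number \<open>m\<close> stand in for \<open>n\<close> in degree \<open>d\<close>:
  take \<open>m = n\<close> if \<open>n\<close> is finite and any \<open>m \<ge> d\<close> otherwise.
\<close>
lemma card_rg_monomials:
  assumes "\<And>k. k \<le> d \<Longrightarrow> enat k \<le> n \<longleftrightarrow> k \<le> m"
  shows "finite (rg_monomials n d)"
    and "card (rg_monomials n d) = (\<Sum>k\<le>m. card (rg_words k d))"
proof -
  have eq: "rg_monomials n d = (\<Union>k\<le>m. rg_words k d)"
  proof (rule set_eqI)
    fix w :: "nat list"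
    have "enat (card (set w)) \<le> n \<longleftrightarrow> card (set w) \<le> m" if "length w = d"
      using assms[of "card (set w)"] card_length[of w] that by simp
    then show "w \<in> rg_monomials n d \<longleftrightarrow> w \<in> (\<Union>k\<le>m. rg_words k d)"
      by (auto simp: rg_monomials_def rg_words_def restricted_growth_monomial_iff)
  qed
  show "finite (rg_monomials n d)" unfolding eq by (simp add: finite_rg_words)
  show "card (rg_monomials n d) = (\<Sum>k\<le>m. card (rg_words k d))"
    unfolding eq by (rule card_UN_disjoint) (use finite_rg_words in \<open>auto simp: rg_words_def\<close>)
qed

lemma card_part_shapes:
  assumes "\<And>k. k \<le> d \<Longrightarrow> enat k \<le> n \<longleftrightarrow> k \<le> m"
  shows "finite (part_shapes n d)" and "card (part_shapes n d) = card (multisets m d)"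
proof -
  have eq: "part_shapes n d = {\<mu>. 0 \<notin># \<mu> \<and> size \<mu> \<le> m \<and> sum_mset \<mu> = d}"
    \<comment> \<open>Positive parts number at most \<open>d\<close>, so the assumption covers every
      size that occurs.\<close>
    using assms size_le_sum_mset by (auto simp: part_shapes_def)
  show "card (part_shapes n d) = card (multisets m d)"
    unfolding eq by (rule card_partitions_eq_card_multisets)
  have "part_shapes n d \<subseteq> (\<Union>k\<le>m. multisets k d)"
    unfolding eq by (auto simp: multisets_def)
  then show "finite (part_shapes n d)"
    by (rule finite_subset) (simp add: finite_multisets)
qed

theorem theorem1p1:
  fixes n :: enat
  assumes "n \<ge> 1"
  shows "\<exists>(C :: (nat list \<Rightarrow> 'k::field_char_0) set)
            (\<phi> :: (nat list \<Rightarrow> 'k) \<Rightarrow> (nat list \<times> nat list \<Rightarrow> 'k)).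
           graded_subspace C (NCSym n) \<and>
           linear_iso_betw \<phi> (NCSym n) (tensor_space C (Lambda n)) \<and>
           (\<forall>d. \<phi> ` degree_part d (NCSym n) = tensor_degree_part d C (Lambda n))"
proof -
  define bnd where "bnd d = (case n of enat m \<Rightarrow> m | \<infinity> \<Rightarrow> d)" for d
  \<comment> \<open>The coefficients are nonnegative by \<open>quotient_fps_bounds\<close>, so
    \<open>nat\<close> loses nothing.\<close>
  define c where "c i = nat (quotient_fps (bnd i) $ i)" for i
  have bnd: "enat k \<le> n \<longleftrightarrow> k \<le> bnd d" if "k \<le> d" for k d
    using that by (simp add: bnd_def split: enat.splits)
  \<comment> \<open>For infinite \<open>n\<close> the quotient series varies with \<open>d\<close>;
    stability makes one sequence \<open>c\<close> serve all degrees.\<close>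
  have c: "int (c i) = quotient_fps (bnd d) $ i" if "i \<le> d" for i d
    using that quotient_fps_bounds quotient_fps_stable[of i d]
    by (simp add: c_def bnd_def split: enat.splits)
  let ?B = "NCSym_basis n :: nat \<Rightarrow> (nat list \<Rightarrow> 'k) set"
  let ?L = "\<lambda>d. bold_m n ` part_shapes n d :: (nat list \<Rightarrow> 'k) set"
  have cardL: "card (?L j) = card (multisets (bnd d) j)" if "j \<le> d" for j d
    using card_part_shapes(2)[of j n "bnd d"] bnd[of _ d] that by (simp add: card_image inj_on_bold_m)
  have "\<exists>C (\<phi> :: (nat list \<Rightarrow> 'k) \<Rightarrow> (nat list \<times> nat list \<Rightarrow> 'k)).
           graded_subspace C (fs.span (\<Union>d. ?B d)) \<and>
           linear_iso_betw \<phi> (fs.span (\<Union>d. ?B d)) (tensor_space C (fs.span (\<Union>d. ?L d))) \<and>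
           (\<forall>d. \<phi> ` degree_part d (fs.span (\<Union>d. ?B d)) =
                tensor_degree_part d C (fs.span (\<Union>d. ?L d)))"
  proof (rule graded_tensor_decomposition)
    show "length w = d" if b: "b \<in> ?B d" "b w \<noteq> 0" for d b w
    proof -
      obtain v where "v \<in> rg_monomials n d" "b = m_fun n (word_type v)"
        using b(1) by (auto simp: NCSym_basis_def)
      with b(2) have "length v = d" "word_type w = word_type v"
        by (simp_all add: rg_monomials_def m_fun_def split: if_splits)
      then show ?thesis using length_eq_if_word_type_eq by metis
    qed
    show "length w = d" if "b \<in> ?L d" "b w \<noteq> 0" for d b w
      using that sum_mset_shape_word_type[of w]
      by (auto simp: part_shapes_def bold_m_nonzero_iff)
    show "finite (?B d)" for d
      unfolding NCSym_basis_def using card_rg_monomials(1)[OF bnd] by blast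
    show "finite (?L d)" for d
      using card_part_shapes(1)[OF bnd] by blast
    show "card (?B d) = (\<Sum>i\<le>d. c i * card (?L (d - i)))" for d
    proof -
      have "int (card (?B d)) = (\<Sum>k\<le>bnd d. int (card (rg_words k d)))"
        unfolding NCSym_basis_def card_image[OF inj_on_m_fun_word_type]
        by (simp add: card_rg_monomials(2)[OF bnd])
      also have "\<dots> = (\<Sum>i\<le>d. int (c i) * int (card (?L (d - i))))"
        unfolding card_rg_words_convolution by (intro sum.cong) (simp_all add: c cardL[of _ d])
      also have "\<dots> = int (\<Sum>i\<le>d. c i * card (?L (d - i)))" by simp
      finally show ?thesis by (simp only: of_nat_eq_iff)
    qed
    \<comment> \<open>The empty partition provides the constant needed in degree 0.\<close>
    have "{#} \<in> part_shapes n 0" by (simp add: part_shapes_def zero_enat_def[symmetric])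
    then show "?L 0 \<noteq> {}" by blast
  qed (rule independent_NCSym_basis independent_bold_m)+
  then show ?thesis unfolding NCSym_eq_span Lambda_eq_span .
qed

end
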